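(* There is an absolute constant $C>0$ such that for every integer $N\ge 2$ there is a red/blue edge-coloring of $K_N^{(3)}$ such that every subgraph all of whose edges are red and which has at most two tight components is iterated tripartite, and every set of vertices all of whose triples are blue has size at most $\exp(C\sqrt{\log N})$.
   Context: $K_N^{(3)}$ is the complete $3$-uniform hypergraph on $N$ vertices. A $3$-graph is tightly connected if for any two edges $e,f$ there is a sequence of edges $e=e_0,\dots,e_t=f$ with $e_{i-1}$ and $e_i$ sharing two vertices for each $i$. A tight component of a $3$-graph is a maximal tightly connected subgraph. A blowup of an edge is a complete tripartite $3$-graph; an iterated blowup of an edge is either a blowup of an edge or a $3$-graph formed by placing an iterated blowup of an edge inside one or more parts of a blowup of an edge (iteratively). A $3$-graph is iterated tripartite if it is a subgraph of an iterated blowup of an edge. *)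

theory Defs
  imports Complex_Main
begin

type_synonym 'a hypergraph = "'a set \<times> 'a set set"

abbreviation verts :: "'a hypergraph \<Rightarrow> 'a set" where
  "verts G \<equiv> fst G"

abbreviation edges :: "'a hypergraph \<Rightarrow> 'a set set" where
  "edges G \<equiv> snd G"

definition three_graph :: "'a hypergraph \<Rightarrow> bool" where
  "three_graph G \<longleftrightarrow> finite (verts G) \<and> (\<forall>e\<in>edges G. e \<subseteq> verts G \<and> card e = 3)"

definition subgraph :: "'a hypergraph \<Rightarrow> 'a hypergraph \<Rightarrow> bool" where
  "subgraph H G \<longleftrightarrow> three_graph H \<and> verts H \<subseteq> verts G \<and> edges H \<subseteq> edges G"

definition complete_three_graph :: "nat \<Rightarrow> nat hypergraph" where
  "complete_three_graph N = ({..<N}, {e. e \<subseteq> {..<N} \<and> card e = 3})"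

definition tight_adj :: "'a hypergraph \<Rightarrow> ('a set \<times> 'a set) set" where
  "tight_adj G = {(e, f). e \<in> edges G \<and> f \<in> edges G \<and> card (e \<inter> f) = 2}"

definition tightly_connected :: "'a hypergraph \<Rightarrow> bool" where
  "tightly_connected G \<longleftrightarrow> (\<forall>e\<in>edges G. \<forall>f\<in>edges G. (e, f) \<in> (tight_adj G)\<^sup>*)"

text \<open>Tight connectivity only constrains edges, so a tight component always contains all
  vertices of the ambient graph.  Hence isolated vertices do not add components, and an
  edgeless graph has exactly one.\<close>

definition tight_component :: "'a hypergraph \<Rightarrow> 'a hypergraph \<Rightarrow> bool" where
  "tight_component G K \<longleftrightarrow> subgraph K G \<and> tightly_connected K \<and>
     (\<forall>K'. subgraph K' G \<and> tightly_connected K' \<and> subgraph K K' \<longrightarrow> K' = K)"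

definition edge_blowup :: "'a set \<Rightarrow> 'a set \<Rightarrow> 'a set \<Rightarrow> 'a hypergraph \<Rightarrow> bool" where
  "edge_blowup A B C G \<longleftrightarrow>
     finite A \<and> finite B \<and> finite C \<and> A \<noteq> {} \<and> B \<noteq> {} \<and> C \<noteq> {} \<and>
     A \<inter> B = {} \<and> A \<inter> C = {} \<and> B \<inter> C = {} \<and>
     G = (A \<union> B \<union> C, {{a, b, c} |a b c. a \<in> A \<and> b \<in> B \<and> c \<in> C})"

inductive iterated_blowup :: "'a hypergraph \<Rightarrow> bool" where
  blowup: "edge_blowup A B C G \<Longrightarrow> iterated_blowup G"
| place: "edge_blowup A B C G \<Longrightarrow> S \<subseteq> {A, B, C} \<Longrightarrow> S \<noteq> {} \<Longrightarrow>
    (\<forall>X\<in>S. iterated_blowup (H X) \<and> verts (H X) \<subseteq> X) \<Longrightarrow>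
    iterated_blowup (verts G, edges G \<union> (\<Union>X\<in>S. edges (H X)))"

text \<open>The iterated blowup may use vertices outside the given graph.  For finite graphs over an
  infinite vertex type such as \<^typ>\<open>nat\<close>, literal containment is therefore the same as
  containment up to isomorphism.\<close>

definition iterated_tripartite :: "'a hypergraph \<Rightarrow> bool" where
  "iterated_tripartite H \<longleftrightarrow> (\<exists>G. iterated_blowup G \<and> subgraph H G)"

datatype colour = Red | Blue

end

theory Submission
  imports Defs "HOL-Library.FuncSet" "HOL-Library.Disjoint_Sets"
begin

text \<open>
  Let \<open>k\<close> be of order \<open>sqrt (log N)\<close>. Vertices are mapped to points of a product of \<open>k (k - 1)\<close> copies of the
  ternary words of length \<open>6 k\<close>, indexed by ordered pairs, and pairs of vertices are labelled by
  names, of which there are only \<open>2^O(k)\<close>. A name consists of three disjoint cylinders in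
  the product, and a triple is red if it meets the three cylinders of the common label of its three pairs.
  Tight components then correspond to labels. The cylinders are chosen such that two points
  cannot be split by two essentially different names at once, so that of two names one is constant on
  the common support; nesting the blowup of the other name in that part shows that the union is iterated tripartite.

  Blue sets are small because a set of points of density \<open>2^(-k\<^sup>2)\<close> meets all three cylinders of some
  name: by Shearer's inequality for the double cover of the index set by stars, the set is
  dense on some star, where a fork of the ternary trees produces the name. A random map from the
  vertices and a random labelling transfer this to all vertex sets of size \<open>2^O(k)\<close>.
\<close>

section \<open>Ternary words\<close>

text \<open>The target exp(O(sqrt(log N))) comes from balancing two counts. Sampling N vertices
  requires uncrossed sets to have density below 1/(3N), hence density 2^(-k^2) with k of order
  sqrt(log N). The blue bound is polynomial in the number of names, so that number must be 2^O(k),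
  although a point has about k^2 coordinates. A name may therefore look only at one star, with 2(k -
  1) coordinates, and at O(1) letters of each on average. Shearer's inequality fits this: k stars
  cover each coordinate twice, and a loss of 4^(-k) on each star amounts to 2^(-k^2) in all. The
  obstacle is compatibility of names from different stars, since the stars of i and j share just the
  coordinates (i, j) and (j, i). Ordered pairs turn these two into a race: the parts of a name at j
  separate at (j, i) before (i, j), those of a name at i do the opposite, and no two points can do
  both. Names at the same j are told apart by their branching nodes at one fixed coordinate.\<close>

definition words :: "nat \<Rightarrow> nat list set" where
  "words h = {w. set w \<subseteq> {..<3} \<and> length w = h}"

definition nodes :: "nat \<Rightarrow> nat list set" where
  "nodes h = {w. set w \<subseteq> {..<3} \<and> length w < h}"

definition fork :: "nat list set \<Rightarrow> nat list \<Rightarrow> bool" where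
  "fork A \<nu> \<longleftrightarrow> (\<forall>s<3. \<exists>w\<in>A. take (Suc (length \<nu>)) w = \<nu> @ [s])"

lemma finite_words [simp]: "finite (words h)"
  and card_words: "card (words h) = 3 ^ h"
  using finite_lists_length_eq[of "{..<3::nat}" h] card_lists_length_eq[of "{..<3::nat}" h]
  by (simp_all add: words_def)

lemma finite_nodes [simp]: "finite (nodes h)"
  by (rule finite_subset[OF _ finite_lists_length_le[of "{..<3::nat}" h]]) (auto simp: nodes_def)

lemma words_Suc: "words (Suc h) = (\<Union>s<3. (#) s ` words h)"
  by (auto simp: words_def length_Suc_conv image_iff)

lemma words_0 [simp]: "words 0 = {[]}"
  by (auto simp: words_def)

lemma nodes_0 [simp]: "nodes 0 = {}"
  by (simp add: nodes_def)

lemma nodes_Suc: "nodes (Suc h) = insert [] (\<Union>s<3. (#) s ` nodes h)"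
proof -
  have "\<nu> \<in> nodes (Suc h) \<longleftrightarrow> \<nu> \<in> insert [] (\<Union>s<3. (#) s ` nodes h)" for \<nu>
    by (cases \<nu>) (auto simp: nodes_def)
  then show ?thesis by blast
qed

lemma sum_words_Suc: "(\<Sum>w\<in>words (Suc h). g w) = (\<Sum>s<3. \<Sum>w\<in>words h. g (s # w))"
  unfolding words_Suc by (subst sum.UNION_disjoint) (auto simp: sum.reindex)

lemma sum_nodes_Suc:
  fixes g :: "nat list \<Rightarrow> 'a::comm_monoid_add"
  shows "(\<Sum>\<nu>\<in>nodes (Suc h). g \<nu>) = g [] + (\<Sum>s<3. \<Sum>\<nu>\<in>nodes h. g (s # \<nu>))"
proof -
  have "(\<Sum>\<nu>\<in>(\<Union>s<3. (#) s ` nodes h). g \<nu>) = (\<Sum>s<3. \<Sum>\<nu>\<in>nodes h. g (s # \<nu>))"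
    by (subst sum.UNION_disjoint) (auto simp: sum.reindex)
  then show ?thesis unfolding nodes_Suc by (subst sum.insert) auto
qed

text \<open>There are 3^l nodes of length l, and the geometric sum is 3^h - 2^h. This is the total
  weight in \<open>card_le_fork_weights\<close> when every node forks.\<close>

lemma sum_node_weights: "(\<Sum>\<nu>\<in>nodes h. 2 ^ (h - length \<nu> - 1)) + 2 ^ h = (3::nat) ^ h"
  by (induction h) (simp_all add: sum_nodes_Suc lessThan_Suc numeral_3_eq_3)

lemma card_nodes: "card (nodes h) \<le> 3 ^ h"
proof -
  have "card (nodes h) \<le> (\<Sum>\<nu>\<in>nodes h. 2 ^ (h - length \<nu> - 1))"
    unfolding card_eq_sum by (intro sum_mono) simp
  then show ?thesis using sum_node_weights[of h] by linarith
qed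

text \<open>Without forks every node has at most two nonempty branches, which leaves 2^h words. A
  fork at \<nu> admits one branch more and pays for it with the size of a binary tree of the
  remaining height h - |\<nu>| - 1.\<close>

lemma card_le_fork_weights:
  "A \<subseteq> words h \<Longrightarrow> card A \<le> 2 ^ h + (\<Sum>\<nu>\<in>nodes h. if fork A \<nu> then 2 ^ (h - length \<nu> - 1) else 0)"
proof (induction h arbitrary: A)
  case 0
  then have "A \<subseteq> {[]}" by (auto simp: words_def)
  then have "card A \<le> card {[]::nat list}" by (intro card_mono) auto
  then show ?case by simp
next
  case (Suc h)
  define T where "T s = {w. s # w \<in> A}" for s
  define F where "F s = (\<Sum>\<nu>\<in>nodes h. if fork (T s) \<nu> then 2 ^ (h - length \<nu> - 1) else (0::nat))" for s
  have T: "T s \<subseteq> words h" for s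
    using Suc.prems by (force simp: T_def words_def)
  have finT: "finite (T s)" for s
    using T finite_subset by fastforce
  have A: "A = (\<Union>s<3. (#) s ` T s)"
  proof -
    have "w \<in> A \<longleftrightarrow> w \<in> (\<Union>s<3. (#) s ` T s)" for w
      using Suc.prems by (cases w) (fastforce simp: T_def words_def)+
    then show ?thesis by blast
  qed
  have cardA: "card A = (\<Sum>s<3. card (T s))"
    by (subst A, subst card_UN_disjoint) (auto simp: finT card_image)
  have fork_Cons: "fork A (s # \<nu>) = fork (T s) \<nu>" for s \<nu>
  proof -
    have "(\<exists>w\<in>A. take (Suc (length (s # \<nu>))) w = (s # \<nu>) @ [r])
        = (\<exists>w\<in>T s. take (Suc (length \<nu>)) w = \<nu> @ [r])" for r
      unfolding T_def by (rule iffI; elim bexE; case_tac w) force+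
    then show ?thesis unfolding fork_def by simp
  qed
  have fork_Nil: "fork A [] = (\<forall>s<3. T s \<noteq> {})"
  proof -
    have "(\<exists>w\<in>A. take (Suc 0) w = [s]) = (T s \<noteq> {})" for s
    proof
      assume "\<exists>w\<in>A. take (Suc 0) w = [s]"
      then obtain w where "w \<in> A" "take (Suc 0) w = [s]" by blast
      then show "T s \<noteq> {}" by (cases w) (auto simp: T_def)
    next
      assume "T s \<noteq> {}"
      then show "\<exists>w\<in>A. take (Suc 0) w = [s]" unfolding T_def by (metis (no_types, lifting) Collect_empty_eq take0 take_Suc_Cons)
    qed
    then show ?thesis by (simp add: fork_def)
  qed
  have IH: "card (T s) \<le> 2 ^ h + F s" for s
    unfolding F_def using Suc.IH[OF T] .
  have R: "(\<Sum>\<nu>\<in>nodes (Suc h). if fork A \<nu> then 2 ^ (Suc h - length \<nu> - 1) else 0)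
      = (if fork A [] then 2 ^ h else 0) + (\<Sum>s<3. F s)"
    by (simp add: sum_nodes_Suc fork_Cons F_def cong: if_cong)
  show ?case
  proof (cases "fork A []")
    case True
    then show ?thesis unfolding R cardA using IH[of 0] IH[of 1] IH[of 2]
      by (simp add: lessThan_Suc numeral_3_eq_3 numeral_2_eq_2)
  next
    case False
    then obtain s where s: "s < 3" "T s = {}" using fork_Nil by auto
    have "s = 0 \<or> s = 1 \<or> s = 2" using s by auto
    then show ?thesis unfolding R cardA using IH[of 0] IH[of 1] IH[of 2] s False
      by (auto simp add: lessThan_Suc numeral_3_eq_3 numeral_2_eq_2)
  qed
qed

section \<open>Common prefixes, and dense sets in products of word sets\<close>

fun lcp :: "nat list \<Rightarrow> nat list \<Rightarrow> nat" where
  "lcp (x # xs) (y # ys) = (if x = y then Suc (lcp xs ys) else 0)"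
| "lcp _ _ = 0"

lemma take_lcp_neq:
  "length xs = length ys \<Longrightarrow> lcp xs ys < length xs \<Longrightarrow> take (Suc (lcp xs ys)) xs \<noteq> take (Suc (lcp xs ys)) ys"
  by (induction xs ys rule: lcp.induct) auto

text \<open>Each further common letter doubles the weight but has probability 1/3: the sum satisfies
  S(h + 1) = 2 S(h) + 2 * 3^h, so the mean of 2^lcp stays bounded however large h is.\<close>

lemma sum_lcp:
  "x \<in> words h \<Longrightarrow> (\<Sum>w\<in>words h. 2 ^ lcp x w) \<le> (3::nat) * 3 ^ h"
proof (induction h arbitrary: x)
  case 0
  then show ?case by simp
next
  case (Suc h)
  then obtain a x' where x: "x = a # x'" "a < 3" "x' \<in> words h" by (auto simp: words_Suc)
  have *: "(\<Sum>w\<in>words h. 2 ^ lcp x (s # w)) = (if s = a then 2 * (\<Sum>w\<in>words h. 2 ^ lcp x' w) else (3::nat) ^ h)" for s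
    by (simp add: x sum_distrib_left card_words flip: card_eq_sum)
  have "a = 0 \<or> a = 1 \<or> a = 2" using x by auto
  then show ?case unfolding sum_words_Suc * using Suc.IH[OF x(3)]
    by (auto simp: lessThan_Suc numeral_3_eq_3 numeral_2_eq_2)
qed

lemma lcp_commute: "lcp xs ys = lcp ys xs"
  by (induction xs ys rule: lcp.induct) auto

lemma take_eq_take_mono: "take n xs = take n ys \<Longrightarrow> m \<le> n \<Longrightarrow> take m xs = take m ys"
  by (metis min.absorb1 take_take)

lemma restrict_eq_imp_eq: "restrict f A = restrict g A \<Longrightarrow> x \<in> A \<Longrightarrow> f x = g x"
  by (metis restrict_apply')

lemma card_eq_sum_card_fibres:
  assumes "finite S" "finite T" "f ` S \<subseteq> T"
  shows "card S = (\<Sum>y\<in>T. card {x\<in>S. f x = y})"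
  using sum.group[OF assms, of "\<lambda>_. 1::nat"] by simp

lemma card_words_PiE: "finite I \<Longrightarrow> card (PiE I (\<lambda>_. words h)) = 3 ^ (h * card I)"
  by (simp add: card_PiE card_words power_mult)

lemma finite_words_PiE [simp]: "finite I \<Longrightarrow> finite (PiE I (\<lambda>_. words h))"
  by (intro finite_PiE) auto

text \<open>Markov's inequality for the exponential moment 2^(sum of the lcp), which factorises over
  the independent coordinates.\<close>

lemma card_large_lcp:
  assumes "finite R" "x \<in> PiE R (\<lambda>_. words h)"
  shows "card {y \<in> PiE R (\<lambda>_. words h). d \<le> (\<Sum>i\<in>R. lcp (x i) (y i))} * 2 ^ d \<le> 3 ^ card R * 3 ^ (h * card R)"
proof -
  let ?P = "PiE R (\<lambda>_. words h)"
  let ?bad = "{y \<in> ?P. d \<le> (\<Sum>i\<in>R. lcp (x i) (y i))}"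
  have "card ?bad * 2 ^ d = (\<Sum>y\<in>?bad. 2 ^ d)" by simp
  also have "\<dots> \<le> (\<Sum>y\<in>?bad. \<Prod>i\<in>R. 2 ^ lcp (x i) (y i))"
    by (intro sum_mono) (simp flip: power_sum)
  also have "\<dots> \<le> (\<Sum>y\<in>?P. \<Prod>i\<in>R. 2 ^ lcp (x i) (y i))"
    using assms by (intro sum_mono2) auto
  also have "\<dots> = (\<Prod>i\<in>R. \<Sum>w\<in>words h. 2 ^ lcp (x i) w)"
    using assms by (subst prod_sum_PiE) auto
  also have "\<dots> \<le> (\<Prod>i\<in>R. 3 * 3 ^ h)"
    using assms by (intro prod_mono) (auto intro!: sum_lcp)
  also have "\<dots> = 3 ^ card R * 3 ^ (h * card R)" by (simp add: power_mult power_mult_distrib)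
  finally show ?thesis .
qed

text \<open>Averages the bound of \<open>card_le_fork_weights\<close> over the sections of \<open>B\<close> in direction \<open>t\<close>: since
  \<open>(2/3)^(6k)\<close> is tiny, one node must be a fork of a \<open>4^(-k)/2\<close> fraction of all sections.\<close>

lemma common_fork:
  assumes fin: "finite I" and t: "t \<notin> I" and B: "B \<subseteq> PiE (insert t I) (\<lambda>_. words (6 * k))"
    and dense: "3 ^ (6 * k * Suc (card I)) < card B * 4 ^ k" and k: "k \<ge> 1"
  obtains \<nu> where "\<nu> \<in> nodes (6 * k)"
    and "3 ^ (6 * k * card I) < card {z \<in> PiE I (\<lambda>_. words (6 * k)). fork ((\<lambda>b. b t) ` {b\<in>B. restrict b I = z}) \<nu>} * (2 * 4 ^ k)"
proof -
  define P where "P = PiE I (\<lambda>_. words (6 * k))"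
  define A where "A z = (\<lambda>b. b t) ` {b\<in>B. restrict b I = z}" for z
  have finP: "finite P" and cardP: "card P = 3 ^ (6 * k * card I)"
    using fin by (auto simp: P_def card_words_PiE)
  have Bw: "b i \<in> words (6 * k)" if "b \<in> B" "i \<in> insert t I" for b i
    using that B by (meson PiE_mem subsetD)
  have finB: "finite B" using fin B by (auto intro: finite_subset)
  have "inj_on (\<lambda>b. b t) {b\<in>B. restrict b I = z}" for z
  proof (rule inj_onI)
    fix b b' assume *: "b \<in> {b\<in>B. restrict b I = z}" "b' \<in> {b\<in>B. restrict b I = z}" "b t = b' t"
    show "b = b'"
    proof (rule PiE_ext[of _ "insert t I" "\<lambda>_. words (6 * k)"])
      show "b i = b' i" if "i \<in> insert t I" for i
        using that * restrict_eq_imp_eq[of b I b' i] by auto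
    qed (use * B in auto)
  qed
  then have "card {b\<in>B. restrict b I = z} = card (A z)" for z
    by (simp add: A_def card_image)
  moreover have "(\<lambda>b. restrict b I) ` B \<subseteq> P"
    using Bw by (auto simp: P_def)
  ultimately have cardB: "card B = (\<Sum>z\<in>P. card (A z))"
    using card_eq_sum_card_fibres[OF finB finP] by simp
  have Aw: "A z \<subseteq> words (6 * k)" for z using Bw by (auto simp: A_def)
  have "\<exists>\<nu>\<in>nodes (6 * k). card P < card {z\<in>P. fork (A z) \<nu>} * (2 * 4 ^ k)"
  proof (rule ccontr)
    assume "\<not> ?thesis"
    then have few: "card {z\<in>P. fork (A z) \<nu>} * (2 * 4 ^ k) \<le> card P" if "\<nu> \<in> nodes (6 * k)" for \<nu>
      using that by force
    \<comment> \<open>The height 6k enters here: 2^6 * 4 = 256 is below 3^6 = 729 by enough to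
      absorb the factor 2.\<close>
    have num: "2 ^ (6 * k) * (2 * 4 ^ k) \<le> (3::nat) ^ (6 * k)"
    proof -
      have "2 * (256::nat) ^ k \<le> 729 ^ k"
        using k by (induction k rule: dec_induct) auto
      moreover have "(256::nat) ^ k = 64 ^ k * 4 ^ k" by (simp flip: power_mult_distrib)
      ultimately show ?thesis by (simp add: power_mult)
    qed
    have "card B \<le> (\<Sum>z\<in>P. 2 ^ (6 * k) + (\<Sum>\<nu>\<in>nodes (6 * k). if fork (A z) \<nu> then 2 ^ (6 * k - length \<nu> - 1) else 0))"
      unfolding cardB by (intro sum_mono card_le_fork_weights Aw)
    also have "\<dots> = card P * 2 ^ (6 * k) + (\<Sum>\<nu>\<in>nodes (6 * k). \<Sum>z\<in>P. if fork (A z) \<nu> then 2 ^ (6 * k - length \<nu> - 1) else 0)"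
      by (simp add: sum.distrib sum.swap[of _ P])
    also have "\<dots> = card P * 2 ^ (6 * k) + (\<Sum>\<nu>\<in>nodes (6 * k). card {z\<in>P. fork (A z) \<nu>} * 2 ^ (6 * k - length \<nu> - 1))"
      using finP by (simp add: sum.If_cases Int_def)
    finally have "card B * (2 * 4 ^ k) \<le> card P * (2 ^ (6 * k) * (2 * 4 ^ k))
        + (\<Sum>\<nu>\<in>nodes (6 * k). card {z\<in>P. fork (A z) \<nu>} * (2 * 4 ^ k) * 2 ^ (6 * k - length \<nu> - 1))"
      by (drule_tac mult_le_mono1[of _ _ "2 * 4 ^ k"]) (simp add: sum_distrib_left sum_distrib_right algebra_simps)
    also have "\<dots> \<le> card P * (2 ^ (6 * k) * (2 * 4 ^ k))
        + (\<Sum>\<nu>\<in>nodes (6 * k). card P * 2 ^ (6 * k - length \<nu> - 1))"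
      by (intro add_mono sum_mono mult_right_mono few) auto
    also have "\<dots> \<le> card P * 3 ^ (6 * k) + card P * 3 ^ (6 * k)"
      unfolding sum_distrib_left[symmetric]
      by (intro add_mono mult_left_mono num) (use sum_node_weights[of "6 * k"] in linarith)+
    also have "\<dots> = 2 * 3 ^ (6 * k * Suc (card I))"
      by (simp add: cardP power_add algebra_simps)
    finally show False using dense by simp
  qed
  then show ?thesis using that unfolding P_def[symmetric] A_def cardP[symmetric] by blast
qed

text \<open>For a star at j, \<open>t\<close> will be the hub, \<open>V\<close> the coordinates (i,
  j) and \<open>R\<close> the other coordinates (j, i). Agreement on \<open>V\<close> together with
  early separation on \<open>R\<close> and \<open>t\<close> is what \<open>before\<close> asks for.
  The three points cannot come from one section, as they would then agree on \<open>R\<close> too;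
  since \<open>common_fork\<close> provides one node for many sections, the three branches can be
  taken from three different sections.\<close>

lemma dense_star:
  assumes fin: "finite V" "finite R" and disj: "t \<notin> V" "t \<notin> R" "V \<inter> R = {}"
    and B: "B \<subseteq> PiE (insert t (V \<union> R)) (\<lambda>_. words (6 * k))"
    and dense: "3 ^ (6 * k * Suc (card V + card R)) < card B * 4 ^ k"
    and k: "k \<ge> 1" and R: "card R \<le> k"
  shows "\<exists>\<nu>\<in>nodes (6 * k). \<exists>x. (\<forall>\<alpha><3. x \<alpha> \<in> B \<and> take (Suc (length \<nu>)) (x \<alpha> t) = \<nu> @ [\<alpha>]) \<and>
      (\<forall>\<alpha><3. \<forall>\<beta><3. (\<forall>i\<in>V. x \<alpha> i = x \<beta> i) \<and> (\<alpha> \<noteq> \<beta> \<longrightarrow> (\<Sum>i\<in>R. lcp (x \<alpha> i) (x \<beta> i)) < 6 * k))"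
proof -
  let ?W = "\<lambda>_. words (6 * k)"
  let ?I = "V \<union> R"
  have cI: "card ?I = card V + card R" using fin disj by (simp add: card_Un_disjoint)
  obtain \<nu> where \<nu>: "\<nu> \<in> nodes (6 * k)" and
    many: "3 ^ (6 * k * card ?I) < card {z \<in> PiE ?I ?W. fork ((\<lambda>b. b t) ` {b\<in>B. restrict b ?I = z}) \<nu>} * (2 * 4 ^ k)"
    using common_fork[of ?I t B k] fin disj B dense k unfolding cI by auto
  define Z where "Z = {z \<in> PiE ?I ?W. fork ((\<lambda>b. b t) ` {b\<in>B. restrict b ?I = z}) \<nu>}"
  have finZ: "finite Z" using fin by (simp add: Z_def)
  have Zw: "z i \<in> words (6 * k)" if "z \<in> Z" "i \<in> ?I" for z i
    using that unfolding Z_def by (metis (mono_tags, lifting) PiE_mem mem_Collect_eq)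
  define P where "P = PiE R ?W"
  define F where "F v = (\<lambda>z. restrict z R) ` {z\<in>Z. restrict z V = v}" for v
  have FP: "F v \<subseteq> P" for v using Zw by (auto simp: F_def P_def)
  have finP: "finite P" and cardP: "card P = 3 ^ (6 * k * card R)"
    using fin by (auto simp: P_def card_words_PiE)
  have inj: "inj_on (\<lambda>z. restrict z R) {z\<in>Z. restrict z V = v}" for v
  proof (rule inj_onI)
    fix z z' assume *: "z \<in> {z\<in>Z. restrict z V = v}" "z' \<in> {z\<in>Z. restrict z V = v}" "restrict z R = restrict z' R"
    show "z = z'"
    proof (rule PiE_ext[of _ ?I ?W])
      show "z i = z' i" if "i \<in> ?I" for i
        using that * restrict_eq_imp_eq[of z R z' i] restrict_eq_imp_eq[of z V z' i] by auto
    qed (use * in \<open>auto simp: Z_def\<close>)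
  qed
  have cardF: "card {z\<in>Z. restrict z V = v} = card (F v)" for v
    using inj by (simp add: F_def card_image)
  \<comment> \<open>Pigeonhole over the coordinates in \<open>V\<close>, which the three points must share; inside a dense
    fibre they are then picked greedily, avoiding the few points with long common prefixes.\<close>
  have "\<exists>v\<in>PiE V ?W. card P < card (F v) * (2 * 4 ^ k)"
  proof (rule ccontr)
    assume "\<not> ?thesis"
    then have few: "card (F v) * (2 * 4 ^ k) \<le> card P" if "v \<in> PiE V ?W" for v using that by force
    have "card Z = (\<Sum>v\<in>PiE V ?W. card (F v))"
      unfolding cardF[symmetric] using Zw fin by (intro card_eq_sum_card_fibres finZ) auto
    then have "card Z * (2 * 4 ^ k) = (\<Sum>v\<in>PiE V ?W. card (F v) * (2 * 4 ^ k))"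
      by (simp add: sum_distrib_right)
    also have "\<dots> \<le> (\<Sum>v\<in>PiE V ?W. card P)" by (intro sum_mono few)
    also have "\<dots> = 3 ^ (6 * k * card ?I)"
      using fin by (simp add: cardP cI card_words_PiE algebra_simps flip: power_add)
    finally show False using many Z_def by simp
  qed
  then obtain v where big: "card P < card (F v) * (2 * 4 ^ k)" by blast
  define bad where "bad y = {y' \<in> P. 6 * k \<le> (\<Sum>i\<in>R. lcp (y i) (y' i))}" for y
  have bad: "card (bad y) * 64 ^ k \<le> 3 ^ k * card P" if "y \<in> P" for y
  proof -
    have "card (bad y) * 2 ^ (6 * k) \<le> 3 ^ card R * card P"
      using card_large_lcp[of R y "6 * k" "6 * k"] fin that unfolding bad_def P_def cardP[unfolded P_def] by simp
    also have "\<dots> \<le> 3 ^ k * card P" using R by (intro mult_right_mono power_increasing) auto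
    finally show ?thesis by (simp add: power_mult)
  qed
  \<comment> \<open>Two bad sets of density at most (3/64)^k each cannot cover a fibre of density
    above 1/(2 * 4^k).\<close>
  have num: "2 * 3 ^ k * (2 * 4 ^ k) \<le> (64::nat) ^ k"
  proof -
    have "4 * (12::nat) ^ k \<le> 64 ^ k" using k by (induction k rule: dec_induct) auto
    moreover have "(12::nat) ^ k = 3 ^ k * 4 ^ k" by (simp flip: power_mult_distrib)
    ultimately show ?thesis by simp
  qed
  have finbad: "finite (bad y)" for y using finP by (simp add: bad_def)
  have avoid: "\<exists>y2\<in>F v. y2 \<notin> bad y0 \<and> y2 \<notin> bad y1" if "y0 \<in> P" "y1 \<in> P" for y0 y1
  proof (rule ccontr)
    assume "\<not> ?thesis"
    then have "F v \<subseteq> bad y0 \<union> bad y1" by blast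
    then have "card (F v) \<le> card (bad y0 \<union> bad y1)" by (intro card_mono) (simp_all add: finbad)
    then have "card (F v) \<le> card (bad y0) + card (bad y1)" using card_Un_le le_trans by blast
    then have "card (F v) * 64 ^ k \<le> card (bad y0) * 64 ^ k + card (bad y1) * 64 ^ k"
      by (metis add_mult_distrib mult_le_mono1)
    also have "\<dots> \<le> 2 * 3 ^ k * card P" using bad[OF that(1)] bad[OF that(2)] by simp
    finally have "card (F v) * 64 ^ k * (2 * 4 ^ k) \<le> 2 * 3 ^ k * card P * (2 * 4 ^ k)" by (rule mult_le_mono1)
    also have "\<dots> = card P * (2 * 3 ^ k * (2 * 4 ^ k))" by (simp add: mult_ac)
    also have "\<dots> \<le> card P * 64 ^ k" using num by (rule mult_le_mono2)
    finally have "64 ^ k * (card (F v) * (2 * 4 ^ k)) \<le> 64 ^ k * card P" by (simp add: mult_ac)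
    then show False using big by simp
  qed
  have "F v \<noteq> {}" using big by auto
  then obtain y0 where y0: "y0 \<in> F v" by blast
  then obtain y1 where y1: "y1 \<in> F v" "y1 \<notin> bad y0" using avoid[of y0 y0] FP by blast
  then obtain y2 where y2: "y2 \<in> F v" "y2 \<notin> bad y0" "y2 \<notin> bad y1" using avoid[of y0 y1] FP y0 by blast
  define y where "y \<alpha> = (if \<alpha> = 0 then y0 else if \<alpha> = 1 then y1 else y2)" for \<alpha> :: nat
  have yF: "y \<alpha> \<in> F v" for \<alpha> using y0 y1 y2 by (simp add: y_def)
  have *: "(\<Sum>i\<in>R. lcp (y \<alpha> i) (y \<beta> i)) < 6 * k" if "\<alpha> < \<beta>" "\<beta> < 3" for \<alpha> \<beta>
  proof -
    have "\<alpha> = 0 \<and> \<beta> = 1 \<or> \<alpha> = 0 \<and> \<beta> = 2 \<or> \<alpha> = 1 \<and> \<beta> = 2" using that by linarith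
    then have "y \<beta> \<notin> bad (y \<alpha>)" using y1 y2 by (auto simp: y_def)
    then show ?thesis using yF FP by (force simp: bad_def)
  qed
  have shallow: "(\<Sum>i\<in>R. lcp (y \<alpha> i) (y \<beta> i)) < 6 * k" if "\<alpha> < 3" "\<beta> < 3" "\<alpha> \<noteq> \<beta>" for \<alpha> \<beta>
    using *[of \<alpha> \<beta>] *[of \<beta> \<alpha>] that by (cases "\<alpha> < \<beta>") (auto simp: lcp_commute)
  have "\<exists>b\<in>B. take (Suc (length \<nu>)) (b t) = \<nu> @ [\<alpha>] \<and> restrict b V = v \<and> restrict b R = y \<alpha>" if "\<alpha> < 3" for \<alpha>
  proof -
    have "y \<alpha> \<in> (\<lambda>z. restrict z R) ` {z \<in> Z. restrict z V = v}" using yF[of \<alpha>] by (simp only: F_def)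
    then obtain z where z: "z \<in> Z" "restrict z V = v" "restrict z R = y \<alpha>" by (elim imageE CollectE conjE) simp
    then have "fork ((\<lambda>b. b t) ` {b\<in>B. restrict b ?I = z}) \<nu>" by (simp add: Z_def)
    then have "\<exists>w\<in>(\<lambda>b. b t) ` {b\<in>B. restrict b ?I = z}. take (Suc (length \<nu>)) w = \<nu> @ [\<alpha>]"
      using that unfolding fork_def by simp
    then obtain b where b: "b \<in> B" "restrict b ?I = z" "take (Suc (length \<nu>)) (b t) = \<nu> @ [\<alpha>]"
      by blast
    have "restrict b V = restrict (restrict b ?I) V" "restrict b R = restrict (restrict b ?I) R"
      by (simp_all add: Int_absorb1 Int_commute)
    then have "restrict b V = v" "restrict b R = y \<alpha>" unfolding b(2) z by simp_all
    then show ?thesis using b by blast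
  qed
  then obtain x where x: "\<And>\<alpha>. \<alpha> < 3 \<Longrightarrow> x \<alpha> \<in> B \<and> take (Suc (length \<nu>)) (x \<alpha> t) = \<nu> @ [\<alpha>] \<and>
      restrict (x \<alpha>) V = v \<and> restrict (x \<alpha>) R = y \<alpha>" by (metis (no_types))
  have "x \<alpha> i = x \<beta> i" if "\<alpha> < 3" "\<beta> < 3" "i \<in> V" for \<alpha> \<beta> i
    using x that restrict_eq_imp_eq by metis
  moreover have "(\<Sum>i\<in>R. lcp (x \<alpha> i) (x \<beta> i)) < 6 * k" if "\<alpha> < 3" "\<beta> < 3" "\<alpha> \<noteq> \<beta>" for \<alpha> \<beta>
  proof -
    have "x \<alpha> i = y \<alpha> i" "x \<beta> i = y \<beta> i" if "i \<in> R" for i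
      using x[OF \<open>\<alpha> < 3\<close>] x[OF \<open>\<beta> < 3\<close>] that by (metis restrict_apply')+
    then have "(\<Sum>i\<in>R. lcp (x \<alpha> i) (x \<beta> i)) = (\<Sum>i\<in>R. lcp (y \<alpha> i) (y \<beta> i))"
      by simp
    then show ?thesis using shallow that by simp
  qed
  ultimately show ?thesis using x \<nu> by blast
qed

section \<open>Shearer's inequality for double covers\<close>

text \<open>Cauchy-Schwarz for the square roots of \<open>p\<close> and \<open>q\<close>, in a form
  free of roots. The cross term of the induction step is bounded by the inequality of arithmetic and
  geometric means.\<close>

lemma sum_square_le_mult_sums:
  fixes a p q :: "'a \<Rightarrow> real"
  assumes "finite S" and "\<And>s. s \<in> S \<Longrightarrow> 0 \<le> p s \<and> 0 \<le> q s \<and> (a s)\<^sup>2 \<le> p s * q s"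
  shows "(\<Sum>s\<in>S. a s)\<^sup>2 \<le> (\<Sum>s\<in>S. p s) * (\<Sum>s\<in>S. q s)"
  using assms
proof (induction S rule: finite_induct)
  case (insert s S)
  let ?A = "sum a S" and ?P = "sum p S" and ?Q = "sum q S"
  have nn: "0 \<le> ?P" "0 \<le> ?Q" "0 \<le> p s" "0 \<le> q s"
    using insert.prems by (auto intro: sum_nonneg)
  have A: "?A\<^sup>2 \<le> ?P * ?Q" using insert by auto
  have a: "(a s)\<^sup>2 \<le> p s * q s" using insert.prems by auto
  have "(2 * ?A * a s)\<^sup>2 = 4 * (?A\<^sup>2 * (a s)\<^sup>2)" by (simp add: power2_eq_square)
  also have "\<dots> \<le> 4 * ((?P * ?Q) * (p s * q s))"
    using mult_mono[OF A a] nn by auto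
  also have "\<dots> \<le> (?P * q s + p s * ?Q)\<^sup>2"
    using zero_le_power2[of "?P * q s - p s * ?Q"] by (simp add: power2_eq_square algebra_simps)
  finally have "2 * ?A * a s \<le> ?P * q s + p s * ?Q"
    by (rule power2_le_imp_le) (use nn in auto)
  then show ?case using insert.hyps A a by (simp add: power2_eq_square algebra_simps)
qed simp

text \<open>One coordinate \<open>e\<close> is eliminated at a time, by slicing \<open>A\<close>
  according to its value. For the two sets \<open>E p\<close>, \<open>E q\<close> that contain
  \<open>e\<close>, the projections of different slices are disjoint, so their sizes add up; for any
  other \<open>E j\<close> the projection of a slice lies in that of \<open>A\<close>.
  Cauchy-Schwarz over the slices combines the two sums.\<close>

lemma card_square_le_prod_card_projections:
  assumes "finite I" "finite J" "\<And>i. i \<in> I \<Longrightarrow> card {j\<in>J. i \<in> E j} = 2"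
    and "\<And>i. i \<in> I \<Longrightarrow> finite (W i)" and "A \<subseteq> PiE I W"
  shows "(card A)\<^sup>2 \<le> (\<Prod>j\<in>J. card ((\<lambda>\<omega>. restrict \<omega> (E j)) ` A))"
  using assms(1,3-)
proof (induction I arbitrary: A rule: finite_induct)
  case empty
  then have "A = {} \<or> A = {\<lambda>_. undefined}" by auto
  then show ?case by auto
next
  case (insert e I)
  let ?r = "\<lambda>j \<omega>. restrict \<omega> (E j)"
  define As where "As s = (\<lambda>\<omega>. restrict \<omega> I) ` {\<omega>\<in>A. \<omega> e = s}" for s
  have fin: "finite A"
    by (rule finite_subset[OF insert.prems(3)], rule finite_PiE) (use insert in auto)
  have undef: "\<omega> x = undefined" if "\<omega> \<in> A" "x \<notin> insert e I" for \<omega> x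
    using that insert.prems by (meson PiE_arb in_mono)
  have AsI: "As s \<subseteq> PiE I W" for s
    using insert.prems(3) by (fastforce simp: As_def)
  have IH: "(card (As s))\<^sup>2 \<le> (\<Prod>j\<in>J. card (?r j ` As s))" for s
    by (rule insert.IH[OF _ _ AsI]) (use insert.prems in auto)
  have inj: "inj_on (\<lambda>\<omega>. restrict \<omega> I) {\<omega>\<in>A. \<omega> e = s}" for s
  proof (rule inj_onI, rule ext)
    fix \<omega> \<omega>' x
    assume *: "\<omega> \<in> {\<omega>\<in>A. \<omega> e = s}" "\<omega>' \<in> {\<omega>\<in>A. \<omega> e = s}" "restrict \<omega> I = restrict \<omega>' I"
    then have "x \<in> I \<Longrightarrow> \<omega> x = \<omega>' x" by (metis restrict_apply')
    then show "\<omega> x = \<omega>' x" using * undef[of \<omega> x] undef[of \<omega>' x]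
      by (cases "x \<in> I"; cases "x = e") simp_all
  qed
  have "card A = card (\<Union>s\<in>(\<lambda>\<omega>. \<omega> e) ` A. {\<omega>\<in>A. \<omega> e = s})" by (rule arg_cong[of _ _ card]) auto
  also have "\<dots> = (\<Sum>s\<in>(\<lambda>\<omega>. \<omega> e) ` A. card {\<omega>\<in>A. \<omega> e = s})"
    using fin by (intro card_UN_disjoint) auto
  also have "\<dots> = (\<Sum>s\<in>(\<lambda>\<omega>. \<omega> e) ` A. card (As s))"
    using inj by (simp add: As_def card_image)
  finally have cardA: "card A = (\<Sum>s\<in>(\<lambda>\<omega>. \<omega> e) ` A. card (As s))" .
  obtain p q where pq: "p \<noteq> q" "{j\<in>J. e \<in> E j} = {p, q}"
    using insert.prems(1)[of e] by (auto simp: card_2_iff)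
  have J: "J = insert p (insert q (J - {p, q}))" using pq by auto
  have other: "card (?r j ` As s) \<le> card (?r j ` A)" if "j \<in> J - {p, q}" for j s
  proof (rule card_mono)
    have "e \<notin> E j" using that pq by auto
    then have "?r j (restrict \<omega> I) = ?r j \<omega>" if "\<omega> \<in> A" for \<omega>
      using undef[OF that] by (fastforce simp: restrict_def)
    then show "?r j ` As s \<subseteq> ?r j ` A" by (auto simp: As_def)
  qed (use fin in simp)
  have star: "(\<Sum>s\<in>(\<lambda>\<omega>. \<omega> e) ` A. card (?r j ` As s)) \<le> card (?r j ` A)" if j: "e \<in> E j" for j
  proof -
    have "(\<Sum>s\<in>(\<lambda>\<omega>. \<omega> e) ` A. card (?r j ` As s)) \<le> (\<Sum>s\<in>(\<lambda>\<omega>. \<omega> e) ` A. card (?r j ` {\<omega>\<in>A. \<omega> e = s}))"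
    proof (rule sum_mono)
      fix s
      have "?r j ` As s = (\<lambda>\<omega>. restrict \<omega> I) ` (?r j ` {\<omega>\<in>A. \<omega> e = s})"
        by (simp add: As_def image_image Int_commute)
      then show "card (?r j ` As s) \<le> card (?r j ` {\<omega>\<in>A. \<omega> e = s})"
        using fin by (simp add: card_image_le)
    qed
    also have "\<dots> = card (\<Union>s\<in>(\<lambda>\<omega>. \<omega> e) ` A. ?r j ` {\<omega>\<in>A. \<omega> e = s})"
    proof (rule card_UN_disjoint[symmetric])
      have "\<omega> e = \<omega>' e" if "?r j \<omega> = ?r j \<omega>'" for \<omega> \<omega>' :: "'a \<Rightarrow> 'c"
        using that j by (metis restrict_apply')
      then show "\<forall>s\<in>(\<lambda>\<omega>. \<omega> e) ` A. \<forall>t\<in>(\<lambda>\<omega>. \<omega> e) ` A. s \<noteq> t \<longrightarrow>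
          ?r j ` {\<omega>\<in>A. \<omega> e = s} \<inter> ?r j ` {\<omega>\<in>A. \<omega> e = t} = {}" by blast
    qed (use fin in auto)
    also have "(\<Union>s\<in>(\<lambda>\<omega>. \<omega> e) ` A. ?r j ` {\<omega>\<in>A. \<omega> e = s}) = ?r j ` A" by auto
    finally show ?thesis .
  qed
  define R where "R = (\<Prod>j\<in>J - {p, q}. real (card (?r j ` A)))"
  have R0: "R \<ge> 0" unfolding R_def by (rule prod_nonneg) auto
  have "(\<Sum>s\<in>(\<lambda>\<omega>. \<omega> e) ` A. real (card (As s)))\<^sup>2
      \<le> (\<Sum>s\<in>(\<lambda>\<omega>. \<omega> e) ` A. R * real (card (?r p ` As s))) * (\<Sum>s\<in>(\<lambda>\<omega>. \<omega> e) ` A. real (card (?r q ` As s)))"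
  proof (rule sum_square_le_mult_sums, use fin in simp, intro conjI)
    fix s
    have "real ((card (As s))\<^sup>2) \<le> real (\<Prod>j\<in>J. card (?r j ` As s))" using IH of_nat_mono by blast
    also have "\<dots> = real (card (?r p ` As s)) * (real (card (?r q ` As s)) * (\<Prod>j\<in>J - {p, q}. real (card (?r j ` As s))))"
      using pq \<open>finite J\<close> by (subst J) simp
    also have "\<dots> \<le> real (card (?r p ` As s)) * (real (card (?r q ` As s)) * R)"
      unfolding R_def using other by (intro mult_left_mono prod_mono) auto
    finally show "(real (card (As s)))\<^sup>2 \<le> R * real (card (?r p ` As s)) * real (card (?r q ` As s))"
      by (simp add: mult_ac)
  qed (use R0 in auto)
  also have "\<dots> = R * real (\<Sum>s\<in>(\<lambda>\<omega>. \<omega> e) ` A. card (?r p ` As s)) * real (\<Sum>s\<in>(\<lambda>\<omega>. \<omega> e) ` A. card (?r q ` As s))"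
    by (simp add: sum_distrib_left)
  also have "\<dots> \<le> R * real (card (?r p ` A)) * real (card (?r q ` A))"
  proof -
    have "e \<in> E p" "e \<in> E q" using pq by auto
    then show ?thesis
      by (intro mult_mono order_refl of_nat_mono star) (use R0 in \<open>auto intro: sum_nonneg\<close>)
  qed
  also have "\<dots> = real (\<Prod>j\<in>J. card (?r j ` A))"
    using pq \<open>finite J\<close> by (subst J) (simp add: R_def)
  finally show ?case unfolding cardA by (metis of_nat_le_iff of_nat_power of_nat_sum)
qed

section \<open>Names\<close>

definition pairs :: "nat \<Rightarrow> (nat \<times> nat) set" where
  "pairs k = {(i, l). i < k \<and> l < k \<and> i \<noteq> l}"

definition star :: "nat \<Rightarrow> nat \<Rightarrow> (nat \<times> nat) set" where
  "star k j = {e \<in> pairs k. fst e = j \<or> snd e = j}"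

text \<open>One fixed coordinate of the form (j, i) in each star, at which all names at j branch.
  For k at least 2 it is a member of \<open>pairs k\<close>.\<close>

definition hub :: "nat \<Rightarrow> nat \<times> nat" where
  "hub j = (j, if j = 0 then 1 else 0)"

type_synonym point = "nat \<times> nat \<Rightarrow> nat list"

definition points :: "nat \<Rightarrow> point set" where
  "points k = PiE (pairs k) (\<lambda>_. words (6 * k))"

text \<open>Reading the coordinates \<open>(j, i)\<close> and \<open>(i, j)\<close> in parallel, \<open>x\<close> and \<open>y\<close> separate at \<open>(j, i)\<close>
  strictly first.\<close>

definition before :: "point \<Rightarrow> point \<Rightarrow> nat \<Rightarrow> nat \<Rightarrow> bool" where
  "before x y j i \<longleftrightarrow> (\<exists>d. take d (x (j, i)) \<noteq> take d (y (j, i)) \<and> take d (x (i, j)) = take d (y (i, j)))"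

text \<open>The linear bound on the total length keeps the number of names at 2^O(k); full words on
  a star would have total length of order k^2. The \<open>Suc\<close> admits prefixes of the full
  length 6k.\<close>

definition prefix_systems :: "nat \<Rightarrow> nat \<Rightarrow> point set" where
  "prefix_systems k j = {c \<in> PiE (star k j) (\<lambda>_. nodes (Suc (6 * k))). (\<Sum>e\<in>star k j. length (c e)) \<le> 50 * k}"

definition cylinder :: "nat \<Rightarrow> nat \<Rightarrow> point \<Rightarrow> point set" where
  "cylinder k j c = {x \<in> points k. \<forall>e\<in>star k j. take (length (c e)) (x e) = c e}"

text \<open>A name \<open>(j, \<nu>, c)\<close> stands for three cylinders with coordinates in the star of \<open>j\<close>, any two of
  which separate at every \<open>(j, i)\<close> before they separate at \<open>(i, j)\<close>, and which at \<open>hub j\<close> branch off in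
  the three directions at \<open>\<nu>\<close>.\<close>

type_synonym name = "nat \<times> nat list \<times> (nat \<Rightarrow> point)"

definition names :: "nat \<Rightarrow> name set" where
  "names k = {(j, \<nu>, c). j < k \<and> \<nu> \<in> nodes (6 * k) \<and> c \<in> PiE {..<3} (\<lambda>_. prefix_systems k j) \<and>
     (\<forall>\<alpha><3. \<forall>x\<in>cylinder k j (c \<alpha>). take (Suc (length \<nu>)) (x (hub j)) = \<nu> @ [\<alpha>]) \<and>
     (\<forall>\<alpha><3. \<forall>\<beta><3. \<alpha> \<noteq> \<beta> \<longrightarrow> (\<forall>x\<in>cylinder k j (c \<alpha>). \<forall>y\<in>cylinder k j (c \<beta>). \<forall>i<k. i \<noteq> j \<longrightarrow> before x y j i))}"

definition region :: "nat \<Rightarrow> name \<Rightarrow> nat \<Rightarrow> point set" where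
  "region k m \<alpha> = cylinder k (fst m) (snd (snd m) \<alpha>)"

text \<open>The part of a name that must differ for two names to count as essentially different:
  names with the same home branch at the same node, so their parts of equal index can be
  merged.\<close>

definition home :: "name \<Rightarrow> nat \<times> nat list" where
  "home m = (fst m, fst (snd m))"

section \<open>Stars, and the incompatibility of names\<close>

lemma finite_pairs [simp]: "finite (pairs k)"
  by (rule finite_subset[of _ "{..<k} \<times> {..<k}"]) (auto simp: pairs_def)

lemma card_pairs: "card (pairs k) = k * (k - 1)"
proof -
  have "pairs k = (SIGMA i:{..<k}. {..<k} - {i})" by (auto simp: pairs_def)
  then show ?thesis by simp
qed

lemma finite_star [simp]: "finite (star k j)"
  by (simp add: star_def)

lemma finite_points [simp]: "finite (points k)"
  by (simp add: points_def)

lemma card_points: "card (points k) = 3 ^ (6 * k * (k * (k - 1)))"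
  by (simp add: points_def card_words_PiE card_pairs)

lemma star_decomposition:
  assumes "2 \<le> k" "j < k"
  defines "V \<equiv> (\<lambda>i. (i, j)) ` ({..<k} - {j})" and "R \<equiv> (\<lambda>i. (j, i)) ` ({..<k} - {j, snd (hub j)})"
  shows "star k j = insert (hub j) (V \<union> R)" "finite V" "finite R" "hub j \<notin> V" "hub j \<notin> R" "V \<inter> R = {}"
    "card V = k - 1" "card R = k - 2"
proof -
  show "star k j = insert (hub j) (V \<union> R)"
    using assms(1,2) by (auto simp: V_def R_def star_def pairs_def hub_def)
  show "card V = k - 1" using assms(2) by (simp add: V_def card_image inj_on_def)
  have "card ({..<k} - {j, snd (hub j)}) = card {..<k} - card {j, snd (hub j)}"
    using assms(1,2) by (intro card_Diff_subset) (auto simp: hub_def)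
  also have "\<dots> = k - 2" by (auto simp: hub_def)
  finally show "card R = k - 2" by (simp add: R_def card_image inj_on_def)
qed (auto simp: V_def R_def hub_def)

text \<open>Of the two witnessing depths take the larger: agreement up to it contradicts separation
  within the smaller.\<close>

lemma before_asym: "before x y j i \<Longrightarrow> \<not> before x y i j"
proof
  assume "before x y j i" "before x y i j"
  then obtain d d' where d: "take d (x (j, i)) \<noteq> take d (y (j, i))" "take d (x (i, j)) = take d (y (i, j))"
      and d': "take d' (x (i, j)) \<noteq> take d' (y (i, j))" "take d' (x (j, i)) = take d' (y (j, i))"
    unfolding before_def by blast
  show False using take_eq_take_mono[OF d(2)] take_eq_take_mono[OF d'(2)] d d' nat_le_linear by blast
qed

lemma namesD:
  assumes "m \<in> names k"
  shows "fst m < k"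
    and "\<And>\<alpha> x. \<alpha> < 3 \<Longrightarrow> x \<in> region k m \<alpha> \<Longrightarrow>
      take (Suc (length (snd (home m)))) (x (hub (fst m))) = snd (home m) @ [\<alpha>]"
    and "\<And>\<alpha> \<beta> x y i. \<alpha> < 3 \<Longrightarrow> \<beta> < 3 \<Longrightarrow> \<alpha> \<noteq> \<beta> \<Longrightarrow> x \<in> region k m \<alpha> \<Longrightarrow> y \<in> region k m \<beta> \<Longrightarrow>
      i < k \<Longrightarrow> i \<noteq> fst m \<Longrightarrow> before x y (fst m) i"
  using assms by (auto simp: names_def region_def home_def)

lemma same_home_disjoint:
  assumes "m \<in> names k" "m' \<in> names k" "home m = home m'" "\<alpha> < 3" "\<beta> < 3" "\<alpha> \<noteq> \<beta>"
  shows "region k m \<alpha> \<inter> region k m' \<beta> = {}"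
proof -
  have "fst m = fst m'" using assms(3) by (simp add: home_def)
  then show ?thesis
    using namesD(2)[OF assms(1,4)] namesD(2)[OF assms(2,5)] assms(3,6) by fastforce
qed

text \<open>For different first components the two names claim opposite outcomes of
  \<open>before\<close>. For equal ones, both nodes are prefixes of the same word of
  \<open>x\<close>, so being distinct they have different lengths; then \<open>x\<close> and
  \<open>y\<close> both follow the longer node and cannot part at the shorter one.\<close>

lemma different_home_no_double_split:
  assumes m: "m \<in> names k" "m' \<in> names k" "home m \<noteq> home m'"
    and less: "\<alpha> < 3" "\<beta> < 3" "\<alpha>' < 3" "\<beta>' < 3" and neq: "\<alpha> \<noteq> \<beta>" "\<alpha>' \<noteq> \<beta>'"
    and x: "x \<in> region k m \<alpha>" "x \<in> region k m' \<alpha>'"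
    and y: "y \<in> region k m \<beta>" "y \<in> region k m' \<beta>'"
  shows False
proof (cases "fst m = fst m'")
  case False
  then have "before x y (fst m) (fst m')" "before x y (fst m') (fst m)"
    using namesD(1)[OF m(1)] namesD(1)[OF m(2)] namesD(3)[OF m(1) less(1,2) neq(1) x(1) y(1)]
      namesD(3)[OF m(2) less(3,4) neq(2) x(2) y(2)] by auto
  then show ?thesis using before_asym by blast
next
  case True
  let ?v = "snd (home m)" and ?v' = "snd (home m')"
  have nested: False if "length v < length v'" "\<gamma> \<noteq> \<delta>"
      "take (Suc (length v)) a = v @ [\<gamma>]" "take (Suc (length v)) b = v @ [\<delta>]"
      "take (Suc (length v')) a = v' @ [\<gamma>']" "take (Suc (length v')) b = v' @ [\<delta>']"
    for v v' a b :: "nat list" and \<gamma> \<delta> \<gamma>' \<delta>'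
  proof -
    have "take (Suc (length v)) a = take (Suc (length v)) v'" "take (Suc (length v)) b = take (Suc (length v)) v'"
      using that(1) arg_cong[OF that(5), of "take (Suc (length v))"] arg_cong[OF that(6), of "take (Suc (length v))"]
      by (simp_all add: min_def)
    then have "v @ [\<gamma>] = v @ [\<delta>]" using that(3,4) by metis
    then show False using that(2) by simp
  qed
  have *: "take (Suc (length ?v)) (x (hub (fst m))) = ?v @ [\<alpha>]" "take (Suc (length ?v)) (y (hub (fst m))) = ?v @ [\<beta>]"
       "take (Suc (length ?v')) (x (hub (fst m))) = ?v' @ [\<alpha>']" "take (Suc (length ?v')) (y (hub (fst m))) = ?v' @ [\<beta>']"
    using namesD(2)[OF m(1)] namesD(2)[OF m(2)] x y less True by auto
  have "?v \<noteq> ?v'" using m(3) True by (auto simp: home_def)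
  then have "length ?v \<noteq> length ?v'" using * by auto
  then show ?thesis using nested[OF _ neq(1) *] nested[OF _ neq(2) *(3,4,1,2)] by linarith
qed

section \<open>From a dense projection to a crossed name\<close>

lemma take_of_take_length:
  "length x = length w \<Longrightarrow> take (length (take D w)) x = take D w \<Longrightarrow> take D x = take D w"
  by (metis length_take min.cobounded1 nle_le take_all_iff min_def)

lemma dense_star_crossed:
  assumes k: "2 \<le> k" and j: "j < k" and A: "A \<subseteq> points k"
    and dense: "3 ^ (6 * k * (2 * (k - 1))) < card ((\<lambda>\<omega>. restrict \<omega> (star k j)) ` A) * 4 ^ k"
  shows "\<exists>m\<in>names k. \<forall>\<alpha><3. \<exists>x\<in>A. x \<in> region k m \<alpha>"
proof -
  define V where "V = (\<lambda>i. (i, j)) ` ({..<k} - {j})"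
  define R where "R = (\<lambda>i. (j, i)) ` ({..<k} - {j, snd (hub j)})"
  note dec = star_decomposition[OF k j, folded V_def R_def]
  have rt: "hub j = (j, snd (hub j))" by (simp add: hub_def)
  have rt': "snd (hub j) < k" "snd (hub j) \<noteq> j" using k by (auto simp: hub_def)
  have "star k j \<subseteq> pairs k" by (auto simp: star_def)
  then have wA: "\<omega> e \<in> words (6 * k)" if "\<omega> \<in> A" "e \<in> star k j" for \<omega> e
    using that A unfolding points_def by (meson PiE_mem subsetD)
  have BPiE: "(\<lambda>\<omega>. restrict \<omega> (star k j)) ` A \<subseteq> PiE (insert (hub j) (V \<union> R)) (\<lambda>_. words (6 * k))"
    unfolding dec(1)[symmetric] using wA by auto
  have exp: "Suc (card V + card R) = 2 * (k - 1)" using k dec by simp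
  have "1 \<le> k" "card R \<le> k" using dec k by simp_all
  then obtain \<nu> x where \<nu>: "\<nu> \<in> nodes (6 * k)"
    and x1: "\<forall>\<alpha><3. x \<alpha> \<in> (\<lambda>\<omega>. restrict \<omega> (star k j)) ` A \<and> take (Suc (length \<nu>)) (x \<alpha> (hub j)) = \<nu> @ [\<alpha>]"
    and x2: "\<forall>\<alpha><3. \<forall>\<beta><3. (\<forall>i\<in>V. x \<alpha> i = x \<beta> i) \<and> (\<alpha> \<noteq> \<beta> \<longrightarrow> (\<Sum>i\<in>R. lcp (x \<alpha> i) (x \<beta> i)) < 6 * k)"
    using dense_star[OF dec(2-6) BPiE, unfolded exp, OF dense] by blast
  have xB: "x \<alpha> \<in> (\<lambda>\<omega>. restrict \<omega> (star k j)) ` A" and xt: "take (Suc (length \<nu>)) (x \<alpha> (hub j)) = \<nu> @ [\<alpha>]"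
    if "\<alpha> < 3" for \<alpha>
    using x1 that by blast+
  have xV: "x \<alpha> i = x \<beta> i" if "\<alpha> < 3" "\<beta> < 3" "i \<in> V" for \<alpha> \<beta> i
    using x2 that by blast
  have xR: "(\<Sum>i\<in>R. lcp (x \<alpha> i) (x \<beta> i)) < 6 * k" if "\<alpha> < 3" "\<beta> < 3" "\<alpha> \<noteq> \<beta>" for \<alpha> \<beta>
    using x2 that by blast
  have xw: "x \<alpha> e \<in> words (6 * k)" if "\<alpha> < 3" "e \<in> star k j" for \<alpha> e
    using xB[OF that(1)] wA[OF _ that(2)] that(2) by auto
  have len: "length (x \<alpha> e) = 6 * k" if "\<alpha> < 3" "e \<in> star k j" for \<alpha> e
    using xw[OF that] by (simp add: words_def)
  \<comment> \<open>Cutting all coordinates of \<open>x 0\<close>, \<open>x 1\<close>, \<open>x 2\<close> to these depths keeps the points separated, and the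
    total length stays linear in \<open>k\<close> because the common prefixes are short on average.\<close>
  define l where "l e = lcp (x 0 e) (x 1 e) + lcp (x 0 e) (x 2 e) + lcp (x 1 e) (x 2 e)" for e
  define D where "D i = (if i = snd (hub j) then Suc (length \<nu>) else Suc (l (j, i)))" for i
  \<comment> \<open>The depth depends only on the index other than j, so (j, i) and (i, j) are cut
    at the same depth; this common depth is the witness for \<open>before\<close>.\<close>
  define other where "other e = (if fst e = j then snd e else fst e)" for e :: "nat \<times> nat"
  define c where "c = (\<lambda>\<alpha>\<in>{..<3}. \<lambda>e\<in>star k j. take (D (other e)) (x \<alpha> e))"
  \<comment> \<open>At most 6k at the hub, one letter for each element of \<open>R\<close>, and 6k
    for each of the three pairs of points: 6k + k + 18k = 25k. Both orientations together give the
    50k of \<open>prefix_systems\<close>.\<close>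
  have sumD: "(\<Sum>i\<in>{..<k} - {j}. D i) \<le> 25 * k"
  proof -
    have sumR: "(\<Sum>i\<in>{..<k} - {j, snd (hub j)}. g (j, i)) = (\<Sum>e\<in>R. g e)" for g :: "nat \<times> nat \<Rightarrow> nat"
      by (simp add: R_def sum.reindex inj_on_def)
    have "{..<k} - {j} = insert (snd (hub j)) ({..<k} - {j, snd (hub j)})" using rt' by auto
    then have "(\<Sum>i\<in>{..<k} - {j}. D i) = Suc (length \<nu>) + (\<Sum>i\<in>{..<k} - {j, snd (hub j)}. Suc (l (j, i)))"
      by (simp add: D_def)
    also have "(\<Sum>i\<in>{..<k} - {j, snd (hub j)}. Suc (l (j, i))) = (\<Sum>e\<in>R. Suc (l e))" by (rule sumR)
    also have "\<dots> = card R + ((\<Sum>e\<in>R. lcp (x 0 e) (x 1 e)) + (\<Sum>e\<in>R. lcp (x 0 e) (x 2 e)) + (\<Sum>e\<in>R. lcp (x 1 e) (x 2 e)))"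
      by (simp only: l_def Suc_eq_plus1_left sum.distrib card_eq_sum)
    finally show ?thesis using xR[of 0 1] xR[of 0 2] xR[of 1 2] \<open>card R \<le> k\<close> \<nu> by (simp add: nodes_def)
  qed
  have sumc: "(\<Sum>e\<in>star k j. D (other e)) \<le> 50 * k"
  proof -
    have "star k j = (\<lambda>i. (i, j)) ` ({..<k} - {j}) \<union> (\<lambda>i. (j, i)) ` ({..<k} - {j})"
      using j by (auto simp: star_def pairs_def)
    moreover have "(\<lambda>i. (i, j)) ` ({..<k} - {j}) \<inter> (\<lambda>i. (j, i)) ` ({..<k} - {j}) = {}" by auto
    ultimately have "(\<Sum>e\<in>star k j. D (other e)) =
        (\<Sum>e\<in>(\<lambda>i. (i, j)) ` ({..<k} - {j}). D (other e)) + (\<Sum>e\<in>(\<lambda>i. (j, i)) ` ({..<k} - {j}). D (other e))"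
      by (simp add: sum.union_disjoint)
    also have "\<dots> = (\<Sum>i\<in>{..<k} - {j}. D i) + (\<Sum>i\<in>{..<k} - {j}. D i)"
      by (subst (1 2) sum.reindex) (auto simp: inj_on_def other_def intro!: sum.cong)
    finally show ?thesis using sumD by simp
  qed
  have cP: "c \<alpha> \<in> prefix_systems k j" if "\<alpha> < 3" for \<alpha>
  proof -
    have "(\<Sum>e\<in>star k j. length (c \<alpha> e)) \<le> (\<Sum>e\<in>star k j. D (other e))"
      using that by (intro sum_mono) (simp add: c_def)
    moreover have "c \<alpha> e \<in> nodes (Suc (6 * k))" if "e \<in> star k j" for e
      using xw[OF \<open>\<alpha> < 3\<close> that] \<open>\<alpha> < 3\<close> that set_take_subset[of "D (other e)" "x \<alpha> e"]
      by (auto simp: c_def nodes_def words_def)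
    moreover have "c \<alpha> \<in> extensional (star k j)" using that by (simp add: c_def)
    ultimately show ?thesis using sumc by (auto simp: prefix_systems_def PiE_iff)
  qed
  \<comment> \<open>The depth may exceed 6k, in which case the stored prefix is the whole
    word.\<close>
  have cyl: "take (D (other e)) (\<omega> e) = take (D (other e)) (x \<alpha> e)"
    if "\<omega> \<in> cylinder k j (c \<alpha>)" "\<alpha> < 3" "e \<in> star k j" for \<omega> \<alpha> e
  proof (rule take_of_take_length)
    have "\<omega> e \<in> words (6 * k)"
      using that \<open>star k j \<subseteq> pairs k\<close> unfolding cylinder_def points_def by (auto dest: PiE_mem)
    then show "length (\<omega> e) = length (x \<alpha> e)" using len[OF that(2,3)] by (simp add: words_def)
    show "take (length (take (D (other e)) (x \<alpha> e))) (\<omega> e) = take (D (other e)) (x \<alpha> e)"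
      using that by (simp add: cylinder_def c_def)
  qed
  have in_star: "(j, i) \<in> star k j" "(i, j) \<in> star k j" if "i < k" "i \<noteq> j" for i
    using that j by (auto simp: star_def pairs_def)
  have differ: "take (D i) (x \<alpha> (j, i)) \<noteq> take (D i) (x \<beta> (j, i))" if "\<alpha> < 3" "\<beta> < 3" "\<alpha> \<noteq> \<beta>" "i < k" "i \<noteq> j" for \<alpha> \<beta> i
  proof (cases "i = snd (hub j)")
    case True
    then show ?thesis using xt[OF that(1)] xt[OF that(2)] that(3) rt by (simp add: D_def)
  next
    case False
    then have iR: "(j, i) \<in> R" using that by (auto simp: R_def)
    have "lcp (x \<alpha> (j, i)) (x \<beta> (j, i)) \<le> (\<Sum>e\<in>R. lcp (x \<alpha> e) (x \<beta> e))"
      by (rule member_le_sum[OF iR]) (use dec in auto)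
    also have "\<dots> < 6 * k" using xR that by blast
    finally have "take (Suc (lcp (x \<alpha> (j, i)) (x \<beta> (j, i)))) (x \<alpha> (j, i)) \<noteq> take (Suc (lcp (x \<alpha> (j, i)) (x \<beta> (j, i)))) (x \<beta> (j, i))"
      using len[OF that(1)] len[OF that(2)] in_star[OF that(4,5)] by (intro take_lcp_neq) auto
    moreover have "Suc (lcp (x \<alpha> (j, i)) (x \<beta> (j, i))) \<le> D i"
    proof -
      have "\<alpha> \<in> {0, 1, 2}" "\<beta> \<in> {0, 1, 2}" using that by auto
      then show ?thesis using that(3) False by (auto simp: D_def l_def lcp_commute)
    qed
    ultimately show ?thesis using take_eq_take_mono by blast
  qed
  have "before \<omega> \<omega>' j i" if "\<alpha> < 3" "\<beta> < 3" "\<alpha> \<noteq> \<beta>" "\<omega> \<in> cylinder k j (c \<alpha>)" "\<omega>' \<in> cylinder k j (c \<beta>)" "i < k" "i \<noteq> j"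
    for \<alpha> \<beta> \<omega> \<omega>' i
  proof -
    have o: "other (j, i) = i" "other (i, j) = i" using that by (auto simp: other_def)
    have "(i, j) \<in> V" using that by (auto simp: V_def)
    then have "x \<alpha> (i, j) = x \<beta> (i, j)" using xV that by blast
    then show ?thesis unfolding before_def
      using cyl[OF that(4,1) in_star(1)[OF that(6,7)]] cyl[OF that(5,2) in_star(1)[OF that(6,7)]]
        cyl[OF that(4,1) in_star(2)[OF that(6,7)]] cyl[OF that(5,2) in_star(2)[OF that(6,7)]] differ[OF that(1-3,6,7)]
      unfolding o by metis
  qed
  moreover have "take (Suc (length \<nu>)) (\<omega> (hub j)) = \<nu> @ [\<alpha>]" if "\<alpha> < 3" "\<omega> \<in> cylinder k j (c \<alpha>)" for \<alpha> \<omega>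
  proof -
    have "D (other (hub j)) = Suc (length \<nu>)" by (simp add: D_def other_def hub_def)
    then show ?thesis using cyl[OF that(2,1), of "hub j"] xt[OF that(1)] dec(1) by simp
  qed
  moreover have "c \<in> PiE {..<3} (\<lambda>_. prefix_systems k j)" using cP by (auto simp: c_def)
  ultimately have "(j, \<nu>, c) \<in> names k" using \<nu> j by (simp add: names_def)
  moreover have "\<exists>\<omega>\<in>A. \<omega> \<in> region k (j, \<nu>, c) \<alpha>" if "\<alpha> < 3" for \<alpha>
  proof -
    obtain \<omega> where \<omega>: "\<omega> \<in> A" "x \<alpha> = restrict \<omega> (star k j)" using xB[OF \<open>\<alpha> < 3\<close>] by blast
    then have "\<omega> \<in> cylinder k j (c \<alpha>)" using A that by (auto simp: cylinder_def c_def min_def)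
    then show ?thesis using \<omega> by (auto simp: region_def)
  qed
  ultimately show ?thesis by blast
qed

text \<open>Each coordinate (i, l) lies in the stars of i and l and in no other, so Shearer's
  inequality applies. Every star projection has density at most 4^(-k), and the k of them bound the
  squared density of \<open>A\<close> by 4^(-k^2).\<close>

lemma uncrossed_card:
  assumes k: "2 \<le> k" and A: "A \<subseteq> points k"
    and unc: "\<And>m. m \<in> names k \<Longrightarrow> \<exists>\<alpha><3. A \<inter> region k m \<alpha> = {}"
  shows "card A * 2 ^ k\<^sup>2 \<le> card (points k)"
proof -
  let ?p = "\<lambda>j. card ((\<lambda>\<omega>. restrict \<omega> (star k j)) ` A)"
  have small: "?p j * 4 ^ k \<le> 3 ^ (6 * k * (2 * (k - 1)))" if "j < k" for j
    using dense_star_crossed[OF k that A] unc by (meson disjoint_iff not_le_imp_less)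
  have cover: "card {j \<in> {..<k}. e \<in> star k j} = 2" if "e \<in> pairs k" for e
  proof -
    have "{j \<in> {..<k}. e \<in> star k j} = {fst e, snd e}" "fst e \<noteq> snd e" using that by (auto simp: star_def pairs_def)
    then show ?thesis by simp
  qed
  have "(card A)\<^sup>2 \<le> (\<Prod>j<k. ?p j)"
    using A unfolding points_def
    by (intro card_square_le_prod_card_projections[of "pairs k" "{..<k}" "star k" "\<lambda>_. words (6 * k)"] cover) auto
  then have "(card A)\<^sup>2 * (4 ^ k) ^ k \<le> (\<Prod>j<k. ?p j) * (4 ^ k) ^ k" by (rule mult_le_mono1)
  also have "\<dots> = (\<Prod>j<k. ?p j * 4 ^ k)" by (simp add: prod.distrib)
  also have "\<dots> \<le> (\<Prod>j<k. 3 ^ (6 * k * (2 * (k - 1))))" using small by (intro prod_mono) auto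
  also have "\<dots> = (card (points k))\<^sup>2" by (simp add: card_points algebra_simps flip: power_mult)
  also have "(4 ^ k) ^ k = ((2::nat) ^ k\<^sup>2)\<^sup>2"
    by (simp add: power2_eq_square flip: power_mult power_mult_distrib)
  finally have "(card A * 2 ^ k\<^sup>2)\<^sup>2 \<le> (card (points k))\<^sup>2" by (simp add: power_mult_distrib)
  then show ?thesis by (rule power2_le_imp_le) simp
qed

section \<open>The number of names\<close>

lemma sum_node_sixth_powers: "(\<Sum>\<nu>\<in>nodes h. (1 / 6) ^ length \<nu>) \<le> (2 :: real)"
  by (induction h) (simp_all add: sum_nodes_Suc flip: sum_distrib_left sum_divide_distrib)

text \<open>Weighting each letter by 1/6 and scaling by 6^(50 k) gives every system a weight of at
  least 1, and the total weight factorises over the star. A factor is a geometric series of ratio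
  3/6, hence at most 2, and there are at most 2k factors.\<close>

lemma card_prefix_systems: "card (prefix_systems k j) \<le> 6 ^ (50 * k) * 4 ^ k"
proof -
  let ?W = "\<lambda>_. nodes (Suc (6 * k))"
  have "real (card (prefix_systems k j)) = (\<Sum>c\<in>prefix_systems k j. 1)" by simp
  also have "\<dots> \<le> (\<Sum>c\<in>prefix_systems k j. 6 ^ (50 * k) * (\<Prod>e\<in>star k j. (1 / 6) ^ length (c e)))"
  proof (rule sum_mono)
    fix c assume "c \<in> prefix_systems k j"
    then have "(6::real) ^ (\<Sum>e\<in>star k j. length (c e)) \<le> 6 ^ (50 * k)"
      by (intro power_increasing) (auto simp: prefix_systems_def)
    then show "1 \<le> (6::real) ^ (50 * k) * (\<Prod>e\<in>star k j. (1 / 6) ^ length (c e))"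
      by (simp add: power_one_over divide_simps prod_dividef flip: power_sum)
  qed
  also have "\<dots> \<le> (\<Sum>c\<in>PiE (star k j) ?W. 6 ^ (50 * k) * (\<Prod>e\<in>star k j. (1 / 6) ^ length (c e)))"
    by (rule sum_mono2) (auto simp: prefix_systems_def intro!: finite_PiE mult_nonneg_nonneg prod_nonneg)
  also have "\<dots> = 6 ^ (50 * k) * (\<Prod>e\<in>star k j. \<Sum>\<nu>\<in>nodes (Suc (6 * k)). (1 / 6) ^ length \<nu>)"
    by (subst prod_sum_PiE) (auto simp: sum_distrib_left)
  also have "\<dots> \<le> 6 ^ (50 * k) * (\<Prod>e\<in>star k j. 2)"
    by (intro mult_left_mono prod_mono conjI sum_node_sixth_powers) (auto intro: sum_nonneg)
  also have "\<dots> = 6 ^ (50 * k) * 2 ^ card (star k j)" by simp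
  also have "\<dots> \<le> 6 ^ (50 * k) * 2 ^ (2 * k)"
  proof -
    have "star k j \<subseteq> (\<lambda>i. (i, j)) ` {..<k} \<union> (\<lambda>i. (j, i)) ` {..<k}" by (auto simp: star_def pairs_def)
    then have "card (star k j) \<le> card ((\<lambda>i. (i, j)) ` {..<k} \<union> (\<lambda>i. (j, i)) ` {..<k})" by (intro card_mono) auto
    also have "\<dots> \<le> k + k" by (rule order.trans[OF card_Un_le]) (intro add_mono card_image_le[THEN order.trans]; simp)
    finally show ?thesis by (intro mult_left_mono power_increasing) auto
  qed
  also have "\<dots> = real (6 ^ (50 * k) * 4 ^ k)" by (simp add: power_mult)
  finally show ?thesis by (simp only: of_nat_le_iff)
qed

lemma finite_prefix_systems [simp]: "finite (prefix_systems k j)"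
  by (rule finite_subset[of _ "PiE (star k j) (\<lambda>_. nodes (Suc (6 * k)))"])
    (auto simp: prefix_systems_def intro!: finite_PiE)

lemma names_subset:
  "names k \<subseteq> (SIGMA j:{..<k}. nodes (6 * k) \<times> PiE {..<3} (\<lambda>_. prefix_systems k j))"
  by (auto simp: names_def)

lemma finite_names [simp]: "finite (names k)"
  by (rule finite_subset[OF names_subset]) (auto intro!: finite_PiE finite_cartesian_product)

lemma card_names: "card (names k) \<le> 2 ^ (500 * k)"
proof -
  have "card (names k) \<le> card (SIGMA j:{..<k}. nodes (6 * k) \<times> PiE {..<3::nat} (\<lambda>_. prefix_systems k j))"
    by (rule card_mono[OF _ names_subset]) (auto intro!: finite_PiE finite_cartesian_product)
  also have "\<dots> = (\<Sum>j<k. card (nodes (6 * k)) * card (prefix_systems k j) ^ 3)"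
    by (subst card_SigmaI) (auto simp: card_cartesian_product card_PiE intro!: finite_PiE finite_cartesian_product)
  also have "\<dots> \<le> (\<Sum>j<k. 3 ^ (6 * k) * (6 ^ (50 * k) * 4 ^ k) ^ 3)"
    by (intro sum_mono mult_mono card_nodes power_mono card_prefix_systems) auto
  also have "\<dots> \<le> 2 ^ k * (4 ^ (6 * k) * (8 ^ (50 * k) * 4 ^ k) ^ 3)"
    by (simp, intro mult_mono power_mono) (auto intro: less_imp_le)
  also have "\<dots> = 2 ^ k * ((2 ^ 2) ^ (6 * k) * ((2 ^ 3) ^ (50 * k) * (2 ^ 2) ^ k) ^ 3)" by simp
  \<comment> \<open>469 = 1 + 2 * 6 + 3 * (3 * 50 + 2), after rounding 3 up to 2^2 and 6 up to
    2^3.\<close>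
  also have "\<dots> = 2 ^ (469 * k)" unfolding power_mult[symmetric] power_add[symmetric] by (rule arg_cong[of _ _ "(^) 2"]) simp
  also have "\<dots> \<le> 2 ^ (500 * k)" by (intro power_increasing) auto
  finally show ?thesis .
qed

section \<open>Random maps and labellings\<close>

text \<open>First moment: a \<open>Q\<close>-set missing one part of every name lies in a set of density at most \<open>1/T\<close>, and
  there are at most \<open>3^Q\<close> such sets and \<open>N^Q\<close> choices of the \<open>Q\<close>-set.\<close>

lemma exists_crossing_sample:
  fixes M :: "'m set" and region :: "'m \<Rightarrow> nat \<Rightarrow> 'p set"
  assumes fin: "finite \<Omega>" "\<Omega> \<noteq> {}" "finite M" and M: "card M \<le> Q" and Q: "0 < Q" and T: "3 * N < T"
    and unc: "\<And>A. A \<subseteq> \<Omega> \<Longrightarrow> (\<And>m. m \<in> M \<Longrightarrow> \<exists>\<alpha><3. A \<inter> region m \<alpha> = {}) \<Longrightarrow> card A * T \<le> card \<Omega>"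
  shows "\<exists>X. (\<forall>a<N. X a \<in> \<Omega>) \<and> (\<forall>S\<subseteq>{..<N}. card S = Q \<longrightarrow> (\<exists>m\<in>M. \<forall>\<alpha><3. \<exists>a\<in>S. X a \<in> region m \<alpha>))"
proof -
  let ?all = "PiE {..<N} (\<lambda>_. \<Omega>)"
  let ?Ss = "{S. S \<subseteq> {..<N} \<and> card S = Q}"
  let ?F = "PiE M (\<lambda>_. {..<3::nat})"
  define av where "av f = {\<omega>\<in>\<Omega>. \<forall>m\<in>M. \<omega> \<notin> region m (f m)}" for f
  define cap where "cap S f = PiE {..<N} (\<lambda>a. if a \<in> S then av f else \<Omega>)" for S f
  define bad where "bad = (\<Union>S\<in>?Ss. \<Union>f\<in>?F. cap S f)"
  have "0 < card \<Omega>" using fin by (simp add: card_gt_0_iff)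
  have finF: "finite ?F" using fin by (intro finite_PiE) auto
  have av: "card (av f) * T \<le> card \<Omega>" if "f \<in> ?F" for f
    by (rule unc) (use that in \<open>auto simp: av_def dest: PiE_mem\<close>)
  have cap: "card (cap S f) * T ^ Q \<le> card \<Omega> ^ N" if S: "S \<in> ?Ss" and f: "f \<in> ?F" for S f
  proof -
    have "finite S" using S by (auto intro: finite_subset)
    have eq: "{..<N} = S \<union> ({..<N} - S)" using S by auto
    have "card (cap S f) = (\<Prod>a<N. card (if a \<in> S then av f else \<Omega>))"
      by (simp add: cap_def card_PiE)
    also have "\<dots> = (\<Prod>a\<in>S. card (av f)) * (\<Prod>a\<in>{..<N} - S. card \<Omega>)"
      by (subst eq, subst prod.union_disjoint) (use \<open>finite S\<close> in auto)
    also have "\<dots> = card (av f) ^ Q * card \<Omega> ^ (N - Q)"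
      using S \<open>finite S\<close> by (simp add: card_Diff_subset)
    finally have "card (cap S f) * T ^ Q = (card (av f) * T) ^ Q * card \<Omega> ^ (N - Q)"
      by (simp add: power_mult_distrib mult_ac)
    also have "\<dots> \<le> card \<Omega> ^ Q * card \<Omega> ^ (N - Q)"
      by (intro mult_right_mono power_mono av f) auto
    also have "\<dots> = card \<Omega> ^ N"
    proof -
      have "card S \<le> card {..<N}" using S by (intro card_mono) auto
      then show ?thesis using S by (simp flip: power_add)
    qed
    finally show ?thesis .
  qed
  have nS: "card ?Ss \<le> N ^ Q"
    by (cases "Q \<le> N") (simp_all add: n_subsets binomial_le_pow binomial_eq_0)
  have "card bad * T ^ Q \<le> (\<Sum>S\<in>?Ss. \<Sum>f\<in>?F. card (cap S f)) * T ^ Q"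
    unfolding bad_def
    by (intro mult_le_mono1 order.trans[OF card_UN_le] sum_mono finF) auto
  also have "\<dots> \<le> (\<Sum>S\<in>?Ss. \<Sum>f\<in>?F. card \<Omega> ^ N)"
    unfolding sum_distrib_right by (intro sum_mono cap)
  also have "\<dots> = card ?Ss * 3 ^ card M * card \<Omega> ^ N"
    using fin by (simp add: card_PiE)
  also have "\<dots> \<le> N ^ Q * 3 ^ Q * card \<Omega> ^ N"
    by (intro mult_le_mono1[OF mult_le_mono] nS power_increasing M) simp
  also have "\<dots> = (3 * N) ^ Q * card \<Omega> ^ N" by (simp add: power_mult_distrib)
  also have "\<dots> < T ^ Q * card \<Omega> ^ N"
    using power_strict_mono[OF T _ Q] \<open>0 < card \<Omega>\<close> by (simp only: mult_less_cancel2 zero_less_power)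
  finally have "card bad < card ?all" by (simp add: card_PiE)
  moreover have "finite (cap S f)" for S f
    unfolding cap_def by (intro finite_PiE) (simp_all add: av_def fin)
  then have "finite bad" using finF by (auto simp: bad_def)
  ultimately have "\<not> ?all \<subseteq> bad" using card_mono leD by blast
  then obtain X where X: "X \<in> ?all" "X \<notin> bad" by blast
  have "\<exists>m\<in>M. \<forall>\<alpha><3. \<exists>a\<in>S. X a \<in> region m \<alpha>" if S: "S \<subseteq> {..<N}" "card S = Q" for S
  proof (rule ccontr)
    assume "\<not> ?thesis"
    then have "\<forall>m\<in>M. \<exists>\<alpha><3. \<forall>a\<in>S. X a \<notin> region m \<alpha>" by blast
    then obtain f where f: "\<forall>m\<in>M. f m < 3 \<and> (\<forall>a\<in>S. X a \<notin> region m (f m))" by metis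
    then have "X \<in> cap S (restrict f M)" "restrict f M \<in> ?F"
      using X S by (auto simp: cap_def av_def PiE_iff)
    then show False using X(2) S unfolding bad_def by blast
  qed
  then show ?thesis using X by (intro exI[of _ X]) (auto dest: PiE_mem)
qed

text \<open>Otherwise every name has a part with fewer than \<open>P\<close> points of
  \<open>S\<close>. Deleting these parts costs at most \<open>Q * P\<close> points, and a
  \<open>Q\<close>-set among the rest is crossed by no name.\<close>

lemma crossing_amplified:
  fixes X :: "'a \<Rightarrow> 'p" and region :: "'m \<Rightarrow> nat \<Rightarrow> 'p set"
  assumes fin: "finite S" "finite M" and M: "card M \<le> Q" and S: "Q + Q * P \<le> card S"
    and cross: "\<And>S'. S' \<subseteq> S \<Longrightarrow> card S' = Q \<Longrightarrow> \<exists>m\<in>M. \<forall>\<alpha><3. \<exists>a\<in>S'. X a \<in> region m \<alpha>"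
  shows "\<exists>m\<in>M. \<forall>\<alpha><3. P \<le> card {a\<in>S. X a \<in> region m \<alpha>}"
proof (rule ccontr)
  assume "\<not> ?thesis"
  then have "\<forall>m\<in>M. \<exists>\<alpha><3. card {a\<in>S. X a \<in> region m \<alpha>} < P" by (meson not_le_imp_less)
  then obtain f where f: "\<forall>m\<in>M. f m < 3 \<and> card {a\<in>S. X a \<in> region m (f m)} < P" by metis
  define D where "D = (\<Union>m\<in>M. {a\<in>S. X a \<in> region m (f m)})"
  have "card D \<le> (\<Sum>m\<in>M. card {a\<in>S. X a \<in> region m (f m)})"
    unfolding D_def using fin by (intro card_UN_le)
  also have "\<dots> \<le> (\<Sum>m\<in>M. P)" using f by (intro sum_mono) auto
  also have "\<dots> \<le> Q * P" using M by simp
  finally have "Q \<le> card (S - D)" using S fin D_def by (subst card_Diff_subset) (auto intro: finite_subset)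
  then obtain S' where S': "S' \<subseteq> S - D" "card S' = Q" by (meson obtain_subset_with_card_n)
  then obtain m where m: "m \<in> M" "\<forall>\<alpha><3. \<exists>a\<in>S'. X a \<in> region m \<alpha>" using cross[of S'] by blast
  then obtain a where "a \<in> S'" "X a \<in> region m (f m)" using f by blast
  then show False using S' m(1) by (auto simp: D_def)
qed

text \<open>The blocks are disjoint, so for a uniform labelling the events that a block is entirely
  labelled \<open>m\<close> are independent, each of probability (card M)^(-r). Stated with
  denominators cleared.\<close>

lemma card_PiE_avoiding_blocks:
  assumes "finite \<T>" "finite E" "finite M" "m \<in> M"
    and "\<And>t. t \<in> \<T> \<Longrightarrow> F t \<subseteq> E \<and> card (F t) = r"
    and "disjoint_family_on F \<T>"
  shows "card {f \<in> PiE E (\<lambda>_. M). \<forall>t\<in>\<T>. \<exists>e\<in>F t. f e \<noteq> m} * (card M ^ r) ^ card \<T>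
      \<le> card M ^ card E * (card M ^ r - 1) ^ card \<T>"
  using assms
proof (induction \<T> arbitrary: E rule: finite_induct)
  case empty
  then show ?case by (simp add: card_PiE)
next
  case (insert t \<T>)
  let ?E = "E - F t"
  let ?L = "{f \<in> PiE E (\<lambda>_. M). \<forall>t\<in>insert t \<T>. \<exists>e\<in>F t. f e \<noteq> m}"
  let ?G = "{f \<in> PiE ?E (\<lambda>_. M). \<forall>t\<in>\<T>. \<exists>e\<in>F t. f e \<noteq> m}"
  let ?H = "PiE (F t) (\<lambda>_. M) - {\<lambda>_\<in>F t. m}"
  have Ft: "F t \<subseteq> E" "card (F t) = r" "finite (F t)" using insert.prems by (auto intro: finite_subset)
  have sub: "F s \<subseteq> ?E" if "s \<in> \<T>" for s
    using that insert.prems(4)[of s] insert.prems(5) insert.hyps by (fastforce simp: disjoint_family_on_def)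
  have IH: "card ?G * (card M ^ r) ^ card \<T> \<le> card M ^ card ?E * (card M ^ r - 1) ^ card \<T>"
    by (rule insert.IH) (use insert.prems sub in \<open>auto simp: disjoint_family_on_def\<close>)
  have "card ?L \<le> card (?H \<times> ?G)"
  proof (rule card_inj_on_le[of "\<lambda>f. (restrict f (F t), restrict f ?E)"])
    show "inj_on (\<lambda>f. (restrict f (F t), restrict f ?E)) ?L"
    proof (rule inj_onI)
      fix f g assume *: "f \<in> ?L" "g \<in> ?L" "(restrict f (F t), restrict f ?E) = (restrict g (F t), restrict g ?E)"
      show "f = g"
      proof (rule PiE_ext[of _ E "\<lambda>_. M"])
        show "f e = g e" if "e \<in> E" for e
        proof (cases "e \<in> F t")
          case True
          then show ?thesis using *(3) by (metis prod.inject restrict_apply')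
        next
          case False
          then show ?thesis using *(3) that by (metis DiffI prod.inject restrict_apply')
        qed
      qed (use * in auto)
    qed
    show "(\<lambda>f. (restrict f (F t), restrict f ?E)) ` ?L \<subseteq> ?H \<times> ?G"
    proof (rule image_subsetI)
      fix f assume f: "f \<in> ?L"
      then have fM: "f e \<in> M" if "e \<in> E" for e using that by auto
      have "restrict f (F t) \<noteq> (\<lambda>_\<in>F t. m)"
      proof
        assume eq: "restrict f (F t) = (\<lambda>_\<in>F t. m)"
        obtain e where "e \<in> F t" "f e \<noteq> m" using f by auto
        then show False using fun_cong[OF eq, of e] by simp
      qed
      moreover have "\<exists>e\<in>F s. restrict f ?E e \<noteq> m" if s: "s \<in> \<T>" for s
      proof -
        obtain e where "e \<in> F s" "f e \<noteq> m" using f s by auto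
        then show ?thesis using sub[OF s] by (intro bexI[of _ e]) auto
      qed
      ultimately show "(restrict f (F t), restrict f ?E) \<in> ?H \<times> ?G" using fM Ft by auto
    qed
    have "finite (PiE ?E (\<lambda>_. M))" "finite ?H" using insert.prems Ft by (auto intro!: finite_PiE)
    then show "finite (?H \<times> ?G)" by auto
  qed
  moreover have "card ?H = card M ^ r - 1"
    using Ft insert.prems by (subst card_Diff_singleton) (auto simp: card_PiE)
  ultimately have "card ?L \<le> (card M ^ r - 1) * card ?G" by (simp add: card_cartesian_product)
  then have "card ?L * (card M ^ r) ^ card (insert t \<T>) \<le> (card M ^ r - 1) * card M ^ r * (card ?G * (card M ^ r) ^ card \<T>)"
    using insert.hyps by (simp add: mult_le_mono1 mult_ac)
  also have "\<dots> \<le> (card M ^ r - 1) * card M ^ r * (card M ^ card ?E * (card M ^ r - 1) ^ card \<T>)"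
    by (rule mult_le_mono2[OF IH])
  also have "\<dots> = card M ^ card E * (card M ^ r - 1) ^ card (insert t \<T>)"
  proof -
    have "card M ^ r * card M ^ card ?E = card M ^ card E"
      using Ft insert.prems(1) card_mono[OF insert.prems(1) Ft(1)] by (simp add: card_Diff_subset flip: power_add)
    then show ?thesis using insert.hyps by (simp add: mult_ac)
  qed
  finally show ?case .
qed

text \<open>The probability of avoiding all Q^8 blocks is (1 - q^(-3))^(Q^8), at most exp(-Q^8 /
  Q^3) = exp(-Q^5).\<close>

lemma mult_power_two_power_le:
  fixes q Q :: nat
  assumes "1 \<le> q" "q \<le> Q"
  shows "2 ^ Q ^ 5 * (q ^ 3 - 1) ^ (Q ^ 8) \<le> (q ^ 3) ^ (Q ^ 8)"
proof -
  define a where "a = real (q ^ 3)"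
  have a: "1 \<le> a" "a \<le> real Q ^ 3" using assms by (auto simp: a_def intro: power_mono)
  have Q: "real Q \<ge> 1" using assms by simp
  have "real Q ^ 5 * a \<le> real Q ^ 5 * real Q ^ 3" using a by (intro mult_left_mono) auto
  also have "\<dots> = real Q ^ 8" by (simp flip: power_add)
  finally have le: "real Q ^ 5 \<le> real Q ^ 8 / a" using a by (simp add: field_simps)
  have "(2::real) ^ (Q ^ 5) \<le> exp 1 ^ (Q ^ 5)"
    using exp_ge_add_one_self[of 1] by (intro power_mono) auto
  also have "\<dots> = exp (real Q ^ 5)" by (simp flip: exp_of_nat_mult)
  finally have e: "(2::real) ^ (Q ^ 5) \<le> exp (real Q ^ 5)" .
  have "(1 - 1 / a) ^ (Q ^ 8) \<le> exp (- 1 / a) ^ (Q ^ 8)"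
    using a exp_ge_add_one_self[of "- 1 / a"] by (intro power_mono) auto
  also have "\<dots> = exp (- (real Q ^ 8 / a))" by (simp flip: exp_of_nat_mult)
  also have "\<dots> \<le> exp (- (real Q ^ 5))" using le by simp
  finally have "2 ^ Q ^ 5 * (1 - 1 / a) ^ (Q ^ 8) \<le> exp (real Q ^ 5) * exp (- (real Q ^ 5))"
    using e a by (intro mult_mono) auto
  then have *: "2 ^ Q ^ 5 * (1 - 1 / a) ^ (Q ^ 8) \<le> 1" by (simp flip: exp_add)
  have "real (q ^ 3 - 1) = a * (1 - 1 / a)" using a assms by (simp add: a_def of_nat_diff field_simps)
  then have "real (2 ^ Q ^ 5 * (q ^ 3 - 1) ^ (Q ^ 8)) = (2 ^ Q ^ 5 * (1 - 1 / a) ^ (Q ^ 8)) * a ^ (Q ^ 8)"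
    by (simp add: power_mult_distrib)
  also have "\<dots> \<le> 1 * a ^ (Q ^ 8)" using * a by (intro mult_right_mono) auto
  finally show ?thesis unfolding a_def by (metis mult_1 of_nat_le_iff of_nat_power)
qed

text \<open>The union bound over a label and three numbered parts of size P = Q^4. Choosing them
  costs a factor of at most Q * 2^(3nP), while the P^2 triangles, each monochromatic in the label
  with probability at least Q^(-3), gain exp(-P^2 / Q^3). This needs P to be about 3n Q^3, and 3n <
  Q leads to the fourth power.\<close>

lemma labelling_count:
  fixes q Q n N :: nat
  assumes "1 \<le> q" "q \<le> Q" "3 * n < Q" "N \<le> 2 ^ n"
  shows "q * N ^ (3 * Q ^ 4) * (q ^ 3 - 1) ^ (Q ^ 8) < (q ^ 3) ^ (Q ^ 8)"
proof (cases "(q ^ 3 - 1) ^ (Q ^ 8) = 0")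
  case False
  have "q * N ^ (3 * Q ^ 4) \<le> q * (2 ^ n) ^ (3 * Q ^ 4)"
    using assms by (intro mult_le_mono2 power_mono) auto
  also have "\<dots> < 2 ^ Q * (2 ^ n) ^ (3 * Q ^ 4)"
    using le_less_trans[OF assms(2) less_exp] by (intro mult_strict_right_mono) auto
  also have "\<dots> = 2 ^ (Q + 3 * n * Q ^ 4)" by (simp add: algebra_simps flip: power_mult power_add)
  also have "\<dots> \<le> 2 ^ (Q ^ 5)"
  proof (intro power_increasing)
    have "Q \<le> Q ^ 4" by (rule self_le_power) (use assms in auto)
    then have "Q + 3 * n * Q ^ 4 \<le> (1 + 3 * n) * Q ^ 4" by simp
    also have "\<dots> \<le> Q * Q ^ 4" using assms by (intro mult_le_mono1) auto
    also have "\<dots> = Q ^ 5" by (simp flip: power_Suc)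
    finally show "Q + 3 * n * Q ^ 4 \<le> Q ^ 5" .
  qed simp
  finally have "q * N ^ (3 * Q ^ 4) * (q ^ 3 - 1) ^ (Q ^ 8) < 2 ^ Q ^ 5 * (q ^ 3 - 1) ^ (Q ^ 8)"
    using False unfolding neq0_conv by (intro mult_strict_right_mono)
  also have "\<dots> \<le> (q ^ 3) ^ (Q ^ 8)" by (rule mult_power_two_power_le[OF assms(1,2)])
  finally show ?thesis .
next
  case True
  then show ?thesis unfolding True using assms by simp
qed

lemma mod_add_left_cancel_less:
  fixes i j j' P :: nat
  assumes "(i + j) mod P = (i + j') mod P" "i < P" "j < P" "j' < P"
  shows "j = j'"
  using assms by (auto simp: mod_if[of "i + j"] mod_if[of "i + j'"] split: if_splits)

lemma exists_labelling:
  fixes M :: "'m set"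
  assumes fin: "finite M" and M: "M \<noteq> {}" "card M \<le> Q" and n: "3 * n < Q" "N \<le> 2 ^ n"
  shows "\<exists>f :: nat set \<Rightarrow> 'm. \<forall>m\<in>M. \<forall>A B C. A \<union> B \<union> C \<subseteq> {..<N} \<longrightarrow> A \<inter> B = {} \<longrightarrow> A \<inter> C = {} \<longrightarrow> B \<inter> C = {} \<longrightarrow>
    card A = Q ^ 4 \<longrightarrow> card B = Q ^ 4 \<longrightarrow> card C = Q ^ 4 \<longrightarrow>
    (\<exists>a\<in>A. \<exists>b\<in>B. \<exists>c\<in>C. f {a, b} = m \<and> f {b, c} = m \<and> f {a, c} = m)"
proof -
  define P where "P = Q ^ 4"
  define E where "E = {e. e \<subseteq> {..<N} \<and> card e = 2}"
  define q where "q = card M"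
  define D where "D = {..<3::nat} \<times> {..<P}"
  \<comment> \<open>The Latin square \<open>(i + j) mod P\<close> gives \<open>P\<^sup>2\<close> transversal triangles no two of which share a pair.\<close>
  define F where "F u t = {{u (0, fst t), u (1, snd t)}, {u (1, snd t), u (2, (fst t + snd t) mod P)},
      {u (0, fst t), u (2, (fst t + snd t) mod P)}}" for u :: "nat \<times> nat \<Rightarrow> nat" and t
  define \<T> where "\<T> = {..<P} \<times> {..<P}"
  define bad where "bad m u = {f \<in> PiE E (\<lambda>_. M). \<forall>t\<in>\<T>. \<exists>e\<in>F u t. f e \<noteq> m}" for m u
  \<comment> \<open>The three parts are encoded by one injection of three numbered copies of P
    points, so that their choices can be counted as functions.\<close>
  define U where "U = {u \<in> PiE D (\<lambda>_. {..<N}). inj_on u D}"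
  have q: "1 \<le> q" using fin M by (simp add: q_def card_gt_0_iff Suc_le_eq)
  have finE: "finite E" by (simp add: E_def)
  have cT: "card \<T> = Q ^ 8" by (simp add: \<T>_def P_def card_cartesian_product flip: power_add)
  have "card (bad m u) * (q ^ 3) ^ Q ^ 8 \<le> q ^ card E * (q ^ 3 - 1) ^ Q ^ 8" if m: "m \<in> M" and u: "u \<in> U" for m u
    unfolding bad_def q_def cT[symmetric]
  proof (rule card_PiE_avoiding_blocks[OF _ finE fin m])
    show "finite \<T>" by (simp add: \<T>_def)
    have inj: "u x = u y \<longleftrightarrow> x = y" if "x \<in> D" "y \<in> D" for x y
      using that u by (auto simp: U_def inj_on_eq_iff)
    have uN: "u x < N" if "x \<in> D" for x using that u by (auto simp: U_def dest: PiE_mem)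
    have mem: "(0, i) \<in> D" "(1, j) \<in> D" "(2, (i + j) mod P) \<in> D" if "(i, j) \<in> \<T>" for i j
      using that by (auto simp: D_def \<T>_def)
    show "F u t \<subseteq> E \<and> card (F u t) = 3" if t: "t \<in> \<T>" for t
    proof -
      obtain i j where ij: "t = (i, j)" by fastforce
      note mem = mem[OF t[unfolded ij]]
      show ?thesis
        using mem[THEN uN] inj[OF mem(1,2)] inj[OF mem(1,3)] inj[OF mem(2,3)]
        by (auto simp: F_def E_def ij doubleton_eq_iff card_insert_if)
    qed
    show "disjoint_family_on (F u) \<T>"
      unfolding disjoint_family_on_def
    proof (intro ballI impI)
      fix t t' assume t: "t \<in> \<T>" "t' \<in> \<T>" "t \<noteq> t'"
      obtain i j i' j' where ij: "t = (i, j)" "t' = (i', j')" by fastforce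
      have less: "i < P" "j < P" "i' < P" "j' < P" using t ij by (auto simp: \<T>_def)
      note mem = mem[OF t(1)[unfolded ij]] mem[OF t(2)[unfolded ij]]
      have *: "(i, (i + j) mod P) \<noteq> (i', (i' + j') mod P)" "(j, (i + j) mod P) \<noteq> (j', (i' + j') mod P)"
        using mod_add_left_cancel_less[of i j P j'] mod_add_left_cancel_less[of j i P i'] less t(3) ij
        by (auto simp: add.commute)
      have E: "{u (r, a), u (s, b)} \<noteq> {u (r', a'), u (s', b')}"
        if "(r, a) \<in> D" "(s, b) \<in> D" "(r', a') \<in> D" "(s', b') \<in> D" "r < s" "r' < s'" "(r, s) = (r', s') \<Longrightarrow> (a, b) \<noteq> (a', b')"
        for r s r' s' a b a' b'
        using that inj by (auto simp: doubleton_eq_iff)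
      have ne: "(i, j) \<noteq> (i', j')" using t ij by simp
      have "e \<notin> F u t'" if "e \<in> F u t" for e
        using that * ne unfolding F_def ij fst_conv snd_conv
        by (elim insertE emptyE; simp only: insert_iff empty_iff simp_thms de_Morgan_disj; intro conjI E mem) auto
      then show "F u t \<inter> F u t' = {}" by blast
    qed
  qed
  then have bad: "(\<Sum>m\<in>M. \<Sum>u\<in>U. card (bad m u)) * (q ^ 3) ^ Q ^ 8 \<le> (\<Sum>m\<in>M. \<Sum>u\<in>U. q ^ card E * (q ^ 3 - 1) ^ Q ^ 8)"
    unfolding sum_distrib_right by (intro sum_mono)
  have "finite (PiE D (\<lambda>_. {..<N}))" by (auto simp: D_def intro!: finite_PiE)
  then have finU: "finite U" by (simp add: U_def)
  have cardU: "card U \<le> N ^ (3 * Q ^ 4)"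
  proof -
    have "card U \<le> card (PiE D (\<lambda>_. {..<N}))" by (intro card_mono) (auto simp: U_def D_def intro!: finite_PiE)
    then show ?thesis by (simp add: card_PiE D_def P_def card_cartesian_product)
  qed
  note bad
  also have "(\<Sum>m\<in>M. \<Sum>u\<in>U. q ^ card E * (q ^ 3 - 1) ^ Q ^ 8) = q ^ card E * (q * card U * (q ^ 3 - 1) ^ Q ^ 8)"
    by (simp add: q_def)
  also have "\<dots> \<le> q ^ card E * (q * N ^ (3 * Q ^ 4) * (q ^ 3 - 1) ^ Q ^ 8)"
    by (intro mult_le_mono2 mult_le_mono1 cardU)
  also have "\<dots> < q ^ card E * (q ^ 3) ^ (Q ^ 8)"
    using q M n by (intro mult_strict_left_mono labelling_count) (auto simp: q_def)
  finally have "(\<Sum>m\<in>M. \<Sum>u\<in>U. card (bad m u)) < q ^ card E" using q by simp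
  moreover have "card (\<Union>m\<in>M. \<Union>u\<in>U. bad m u) \<le> (\<Sum>m\<in>M. card (\<Union>u\<in>U. bad m u))"
    by (rule card_UN_le[OF fin])
  moreover have "\<dots> \<le> (\<Sum>m\<in>M. \<Sum>u\<in>U. card (bad m u))"
    by (intro sum_mono card_UN_le finU)
  ultimately have "card (\<Union>m\<in>M. \<Union>u\<in>U. bad m u) < card (PiE E (\<lambda>_. M))"
    using finE by (simp add: card_PiE q_def)
  moreover have "finite (\<Union>m\<in>M. \<Union>u\<in>U. bad m u)"
    using fin finU finE by (auto simp: bad_def intro!: finite_PiE)
  ultimately have "\<not> PiE E (\<lambda>_. M) \<subseteq> (\<Union>m\<in>M. \<Union>u\<in>U. bad m u)" using card_mono leD by blast
  then obtain f where f: "f \<in> PiE E (\<lambda>_. M)" "\<And>m u. m \<in> M \<Longrightarrow> u \<in> U \<Longrightarrow> f \<notin> bad m u" by blast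
  show ?thesis
  proof (intro exI[of _ f] ballI allI impI)
    fix m A B C assume m: "m \<in> M" and sub: "A \<union> B \<union> C \<subseteq> {..<N}"
      and dis: "A \<inter> B = {}" "A \<inter> C = {}" "B \<inter> C = {}"
      and card: "card A = Q ^ 4" "card B = Q ^ 4" "card C = Q ^ 4"
    have "finite A" "finite B" "finite C" using sub by (auto intro: finite_subset)
    then obtain a b c where abc: "bij_betw a {..<P} A" "bij_betw b {..<P} B" "bij_betw c {..<P} C"
      using ex_bij_betw_nat_finite card unfolding P_def atLeast0LessThan by metis
    define u where "u = (\<lambda>x\<in>D. if fst x = 0 then a (snd x) else if fst x = 1 then b (snd x) else c (snd x))"
    have mem: "a i \<in> A" "b i \<in> B" "c i \<in> C" if "i < P" for i
      using that abc by (auto dest: bij_betwE)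
    have inj: "a i = a j \<longleftrightarrow> i = j" "b i = b j \<longleftrightarrow> i = j" "c i = c j \<longleftrightarrow> i = j" if "i < P" "j < P" for i j
      using that abc by (auto simp: bij_betw_def inj_on_eq_iff)
    have ne: "a i \<noteq> b j" "a i \<noteq> c j" "b i \<noteq> c j" if "i < P" "j < P" for i j
      using mem[OF that(1)] mem[OF that(2)] dis by auto
    have "inj_on u D"
    proof (rule inj_onI)
      fix x y assume xy: "x \<in> D" "y \<in> D" "u x = u y"
      then have P: "snd x < P" "snd y < P" by (auto simp: D_def)
      have "fst x \<in> {0, 1, 2}" "fst y \<in> {0, 1, 2}" using xy by (auto simp: D_def)
      then show "x = y"
        using xy inj[OF P] ne[OF P] ne[OF P(2,1)] by (auto simp: u_def prod_eq_iff)
    qed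
    moreover have "a i < N" "b i < N" "c i < N" if "i < P" for i
      using mem[OF that] sub by auto
    then have "u \<in> PiE D (\<lambda>_. {..<N})" by (auto simp: u_def D_def)
    ultimately have "f \<notin> bad m u" using f m by (simp add: U_def)
    then obtain t where t: "t \<in> \<T>" "\<And>e. e \<in> F u t \<Longrightarrow> f e = m" using f by (auto simp: bad_def)
    obtain i j where ij: "t = (i, j)" "i < P" "j < P" using t by (auto simp: \<T>_def)
    have "(i + j) mod P < P" using ij by simp
    then have "F u t = {{a i, b j}, {b j, c ((i + j) mod P)}, {a i, c ((i + j) mod P)}}"
      using ij by (simp add: F_def u_def D_def)
    then show "\<exists>a\<in>A. \<exists>b\<in>B. \<exists>c\<in>C. f {a, b} = m \<and> f {b, c} = m \<and> f {a, c} = m"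
      using t(2) mem ij \<open>(i + j) mod P < P\<close> by (metis insertCI)
  qed
qed

section \<open>Tight components and iterated blowups\<close>

lemma rainbow_edge:
  assumes "card e = 3" "g ` e = {0, 1, 2 :: nat}"
  shows "\<exists>a b c. e = {a, b, c} \<and> g a = 0 \<and> g b = 1 \<and> g c = 2"
proof -
  have "0 \<in> g ` e" "1 \<in> g ` e" "2 \<in> g ` e" using assms(2) by simp_all
  then obtain a b c where abc: "a \<in> e" "g a = 0" "b \<in> e" "g b = 1" "c \<in> e" "g c = 2"
    by (elim imageE) simp
  then have "a \<noteq> b" "a \<noteq> c" "b \<noteq> c" by auto
  then have "card {a, b, c} = card e" using assms(1) by simp
  moreover have "finite e" using assms(1) by (simp add: card_ge_0_finite)
  ultimately have "{a, b, c} = e" using abc by (intro card_subset_eq) auto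
  then show ?thesis using abc by blast
qed

text \<open>Two levels of nesting are all that a pair of names requires: \<open>g\<close> is the
  outer partition and \<open>h\<close> the one placed inside part \<open>s\<close>.\<close>

lemma iterated_tripartite_two_levels:
  fixes H :: "nat hypergraph" and g h :: "nat \<Rightarrow> nat"
  assumes H: "three_graph H" and gh: "\<And>v. v \<in> verts H \<Longrightarrow> g v < 3 \<and> h v < 3"
    and s: "s < 3"
    and edges: "\<And>e. e \<in> edges H \<Longrightarrow> g ` e = {0, 1, 2} \<or> (\<forall>v\<in>e. g v = s) \<and> h ` e = {0, 1, 2}"
  shows "iterated_tripartite H"
proof -
  have fin: "finite (verts H)" using H by (simp add: three_graph_def)
  have edge: "e \<subseteq> verts H" "card e = 3" if "e \<in> edges H" for e
    using H that by (auto simp: three_graph_def)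
  \<comment> \<open>The vertices from \<open>n\<close> to \<open>n + 5\<close> are fresh; they keep all parts nonempty.\<close>
  obtain n where n: "\<And>v. v \<in> verts H \<Longrightarrow> v < n"
    using fin by (meson finite_nat_set_iff_bounded)
  define P where "P i = {v\<in>verts H. g v = i} \<union> {n + i} \<union> (if i = s then {n + 3, n + 4, n + 5} else {})" for i
  define R where "R i = {v\<in>verts H. g v = s \<and> h v = i} \<union> {n + 3 + i}" for i
  define G where "G = (P 0 \<union> P 1 \<union> P 2, {{a, b, c} |a b c. a \<in> P 0 \<and> b \<in> P 1 \<and> c \<in> P 2})"
  define I where "I = (R 0 \<union> R 1 \<union> R 2, {{a, b, c} |a b c. a \<in> R 0 \<and> b \<in> R 1 \<and> c \<in> R 2})"
  have P_disj: "P i \<inter> P j = {}" if "i \<noteq> j" "i < 3" "j < 3" for i j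
    using that by (auto simp: P_def dest!: n)
  have R_disj: "R i \<inter> R j = {}" if "i \<noteq> j" for i j
    using that by (auto simp: R_def dest!: n)
  have fP: "finite (P i)" "P i \<noteq> {}" and fR: "finite (R i)" "R i \<noteq> {}" for i
    using fin by (simp_all add: P_def R_def)
  have G: "edge_blowup (P 0) (P 1) (P 2) G"
    using fP P_disj by (simp add: edge_blowup_def G_def)
  have I: "edge_blowup (R 0) (R 1) (R 2) I"
    using fR R_disj by (simp add: edge_blowup_def I_def)
  have "s = 0 \<or> s = 1 \<or> s = 2" using s by linarith
  then have sub: "{P s} \<subseteq> {P 0, P 1, P 2}" by blast
  have "verts I \<subseteq> P s" by (auto simp: I_def R_def P_def)
  then have "\<forall>X\<in>{P s}. iterated_blowup I \<and> verts I \<subseteq> X" using iterated_blowup.blowup[OF I] by simp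
  then have ib: "iterated_blowup (verts G, edges G \<union> edges I)"
    using iterated_blowup.place[OF G sub, of "\<lambda>_. I"] by simp
  have "verts H \<subseteq> verts G"
  proof
    fix v assume v: "v \<in> verts H"
    then have "g v = 0 \<or> g v = 1 \<or> g v = 2" using gh[OF v] by linarith
    then show "v \<in> verts G" using v by (auto simp: G_def P_def)
  qed
  moreover have "e \<in> edges G \<union> edges I" if e: "e \<in> edges H" for e
    using edges[OF e]
  proof (rule disjE)
    assume "g ` e = {0, 1, 2}"
    from rainbow_edge[OF edge(2)[OF e] this]
    obtain a b c where abc: "e = {a, b, c}" "g a = 0" "g b = 1" "g c = 2" by blast
    then have "a \<in> P 0" "b \<in> P 1" "c \<in> P 2" using edge(1)[OF e] by (simp_all add: P_def)
    then have "e \<in> edges G" unfolding G_def snd_conv using abc(1) by blast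
    then show ?thesis ..
  next
    assume *: "(\<forall>v\<in>e. g v = s) \<and> h ` e = {0, 1, 2}"
    from rainbow_edge[OF edge(2)[OF e] conjunct2[OF this]]
    obtain a b c where abc: "e = {a, b, c}" "h a = 0" "h b = 1" "h c = 2" by blast
    then have "a \<in> R 0" "b \<in> R 1" "c \<in> R 2" using edge(1)[OF e] * by (simp_all add: R_def)
    then have "e \<in> edges I" unfolding I_def snd_conv using abc(1) by blast
    then show ?thesis ..
  qed
  ultimately have "subgraph H (verts G, edges G \<union> edges I)" using H by (auto simp: subgraph_def)
  then show ?thesis using ib unfolding iterated_tripartite_def by blast
qed

text \<open>A tight path starting at \<open>e\<close> never leaves the class of \<open>e\<close>,
  which makes the class connected in itself; any connected subgraph containing it contains
  \<open>e\<close>, so its edges are reachable from \<open>e\<close>. Maximality forces the full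
  vertex set.\<close>

lemma tight_component_of_edge:
  assumes H: "three_graph H" and e: "e \<in> edges H"
  shows "tight_component H (verts H, (tight_adj H)\<^sup>* `` {e})" (is "tight_component H ?K")
proof -
  have stay: "f \<in> edges H" if "(e, f) \<in> (tight_adj H)\<^sup>*" for f
    using that e by (induction rule: rtrancl_induct) (auto simp: tight_adj_def)
  have "sym (tight_adj H)" by (auto simp: sym_def tight_adj_def Int_commute)
  then have sym: "sym ((tight_adj H)\<^sup>*)" by (rule sym_rtrancl)
  have inside: "(f, g) \<in> (tight_adj ?K)\<^sup>*" if "(f, g) \<in> (tight_adj H)\<^sup>*" "(e, f) \<in> (tight_adj H)\<^sup>*" for f g
    using that
  proof (induction rule: rtrancl_induct)
    case (step g g')
    then have "(e, g) \<in> (tight_adj H)\<^sup>*" "(e, g') \<in> (tight_adj H)\<^sup>*" by (meson rtrancl.rtrancl_into_rtrancl rtrancl_trans)+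
    then have "(g, g') \<in> tight_adj ?K" using step.hyps by (auto simp: tight_adj_def)
    then show ?case using step by (meson rtrancl.rtrancl_into_rtrancl)
  qed simp
  have "subgraph ?K H" using H stay by (auto simp: subgraph_def three_graph_def)
  moreover have "tightly_connected ?K"
    unfolding tightly_connected_def
  proof (intro ballI)
    fix f g assume "f \<in> edges ?K" "g \<in> edges ?K"
    then have *: "(e, f) \<in> (tight_adj H)\<^sup>*" "(e, g) \<in> (tight_adj H)\<^sup>*" by auto
    then have "(f, g) \<in> (tight_adj H)\<^sup>*" using sym by (meson rtrancl_trans symD)
    then show "(f, g) \<in> (tight_adj ?K)\<^sup>*" using inside * by blast
  qed
  moreover have "K' = ?K" if K': "subgraph K' H" "tightly_connected K'" "subgraph ?K K'" for K'
  proof -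
    have "tight_adj K' \<subseteq> tight_adj H" using K'(1) by (auto simp: subgraph_def tight_adj_def)
    then have "(tight_adj K')\<^sup>* \<subseteq> (tight_adj H)\<^sup>*" by (rule rtrancl_mono)
    moreover have "e \<in> edges K'" using K'(3) by (auto simp: subgraph_def)
    ultimately have "edges K' \<subseteq> (tight_adj H)\<^sup>* `` {e}" using K'(2) by (auto simp: tightly_connected_def)
    then show ?thesis using K' by (auto simp: subgraph_def prod_eq_iff)
  qed
  ultimately show ?thesis by (auto simp: tight_component_def)
qed

text \<open>Guards against \<open>card\<close> being 0 on an infinite set, which would make a bound
  on the number of components void.\<close>

lemma finite_tight_components:
  assumes "three_graph H"
  shows "finite {K. tight_component H K}"
proof (rule finite_subset)
  show "{K. tight_component H K} \<subseteq> Pow (verts H) \<times> Pow (Pow (verts H))"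
    using assms by (auto simp: tight_component_def subgraph_def three_graph_def) blast
  show "finite (Pow (verts H) \<times> Pow (Pow (verts H)))" using assms by (simp add: three_graph_def)
qed

text \<open>Adjacent edges share a pair, and its value under \<open>f\<close> is the label of both.
  Labels are thus constant on components, though one label may occupy several.\<close>

lemma card_labels_le_tight_components:
  assumes H: "three_graph H" and lab: "\<And>e p. e \<in> edges H \<Longrightarrow> p \<subseteq> e \<Longrightarrow> card p = 2 \<Longrightarrow> f p = lab e"
  shows "finite (lab ` edges H)" "card (lab ` edges H) \<le> card {K. tight_component H K}"
proof -
  have eq: "lab e' = lab e" if "(e, e') \<in> (tight_adj H)\<^sup>*" for e e'
    using that
  proof (induction rule: rtrancl_induct)
    case (step e' e'')
    then show ?case using lab[of e' "e' \<inter> e''"] lab[of e'' "e' \<inter> e''"] by (auto simp: tight_adj_def)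
  qed simp
  define rep where "rep = inv_into (edges H) lab"
  have rep: "rep l \<in> edges H" "lab (rep l) = l" if "l \<in> lab ` edges H" for l
    using that by (simp_all add: rep_def inv_into_into f_inv_into_f)
  let ?K = "\<lambda>l. (verts H, (tight_adj H)\<^sup>* `` {rep l})"
  have inj: "inj_on ?K (lab ` edges H)"
  proof (rule inj_onI)
    fix l l' assume l: "l \<in> lab ` edges H" "l' \<in> lab ` edges H" "?K l = ?K l'"
    then have "(rep l, rep l') \<in> (tight_adj H)\<^sup>*" by auto
    then show "l = l'" using eq rep l by metis
  qed
  have sub: "?K ` lab ` edges H \<subseteq> {K. tight_component H K}"
    using tight_component_of_edge[OF H] rep by blast
  show "finite (lab ` edges H)" using inj sub finite_tight_components[OF H] by (metis finite_imageD finite_subset)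
  show "card (lab ` edges H) \<le> card {K. tight_component H K}"
    by (rule card_inj_on_le[OF inj sub finite_tight_components[OF H]])
qed

definition red_triple :: "('m \<Rightarrow> nat \<Rightarrow> 'a set) \<Rightarrow> ('a set \<Rightarrow> 'm) \<Rightarrow> 'm \<Rightarrow> 'a set \<Rightarrow> bool" where
  "red_triple Z f m e \<longleftrightarrow> (\<exists>a b c. e = {a, b, c} \<and> a \<in> Z m 0 \<and> b \<in> Z m 1 \<and> c \<in> Z m 2 \<and>
     f {a, b} = m \<and> f {b, c} = m \<and> f {a, c} = m)"

lemma red_triple_pair:
  assumes "red_triple Z f m e" "p \<subseteq> e" "card p = 2"
  shows "f p = m"
proof -
  obtain a b c where e: "e = {a, b, c}" "f {a, b} = m" "f {b, c} = m" "f {a, c} = m"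
    using assms(1) by (auto simp: red_triple_def)
  obtain x y where "p = {x, y}" "x \<noteq> y" using assms(3) by (auto simp: card_2_iff)
  then have "p = {a, b} \<or> p = {b, c} \<or> p = {a, c}" using assms(2) e by auto
  then show ?thesis using e by auto
qed

lemma iterated_tripartite_if_two_labels:
  fixes Z :: "'m \<Rightarrow> nat \<Rightarrow> nat set" and home :: "'m \<Rightarrow> 'h"
  assumes H: "three_graph H" and m: "m \<in> M" "m' \<in> M"
    and same: "\<And>m m' \<alpha> \<beta>. m \<in> M \<Longrightarrow> m' \<in> M \<Longrightarrow> home m = home m' \<Longrightarrow> \<alpha> < 3 \<Longrightarrow> \<beta> < 3 \<Longrightarrow> \<alpha> \<noteq> \<beta> \<Longrightarrow> Z m \<alpha> \<inter> Z m' \<beta> = {}"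
    and diff: "\<And>m m' \<alpha> \<beta> \<alpha>' \<beta>' x y. m \<in> M \<Longrightarrow> m' \<in> M \<Longrightarrow> home m \<noteq> home m' \<Longrightarrow> \<alpha> < 3 \<Longrightarrow> \<beta> < 3 \<Longrightarrow> \<alpha>' < 3 \<Longrightarrow> \<beta>' < 3 \<Longrightarrow>
        \<alpha> \<noteq> \<beta> \<Longrightarrow> \<alpha>' \<noteq> \<beta>' \<Longrightarrow> x \<in> Z m \<alpha> \<Longrightarrow> x \<in> Z m' \<alpha>' \<Longrightarrow> y \<in> Z m \<beta> \<Longrightarrow> y \<in> Z m' \<beta>' \<Longrightarrow> False"
    and red: "\<And>e. e \<in> edges H \<Longrightarrow> red_triple Z f m e \<or> red_triple Z f m' e"
  shows "iterated_tripartite H"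
proof -
  \<comment> \<open>The value 3 marks vertices outside all three parts.\<close>
  define \<tau> where "\<tau> m v = (if \<exists>\<alpha><3. v \<in> Z m \<alpha> then (LEAST \<alpha>. v \<in> Z m \<alpha>) else 3)" for m v
  have tau: "\<tau> m v = \<alpha>" if "m \<in> M" "v \<in> Z m \<alpha>" "\<alpha> < 3" for m v \<alpha>
  proof -
    have "(LEAST \<alpha>. v \<in> Z m \<alpha>) = \<alpha>"
    proof (rule Least_equality)
      fix \<beta> assume \<beta>: "v \<in> Z m \<beta>"
      show "\<alpha> \<le> \<beta>"
      proof (rule ccontr)
        assume "\<not> \<alpha> \<le> \<beta>"
        then have "Z m \<alpha> \<inter> Z m \<beta> = {}" using that by (intro same) auto
        then show False using that(2) \<beta> by blast
      qed
    qed (rule that(2))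
    then show ?thesis using that by (auto simp: \<tau>_def)
  qed
  have tauD: "v \<in> Z m (\<tau> m v)" if "m \<in> M" "\<tau> m v < 3" for m v
    using that by (auto simp: \<tau>_def intro: LeastI split: if_splits)
  have image: "g ` e = {0, 1, 2}" if e: "red_triple Z f m e" and g: "\<And>\<alpha> v. \<alpha> < 3 \<Longrightarrow> v \<in> Z m \<alpha> \<Longrightarrow> g v = \<alpha>" for g m e
  proof -
    obtain a b c where "e = {a, b, c}" "a \<in> Z m 0" "b \<in> Z m 1" "c \<in> Z m 2"
      using e unfolding red_triple_def by blast
    then show ?thesis using g[of 0 a] g[of 1 b] g[of 2 c] by simp
  qed
  have in_part: "\<exists>\<alpha><3. v \<in> Z m \<alpha>" if "red_triple Z f m e" "v \<in> e" for m e v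
  proof -
    have "v \<in> Z m 0 \<or> v \<in> Z m 1 \<or> v \<in> Z m 2" using that unfolding red_triple_def by blast
    moreover have "(0::nat) < 3" "(1::nat) < 3" "(2::nat) < 3" by simp_all
    ultimately show ?thesis by blast
  qed
  show ?thesis
  proof (cases "home m = home m'")
    case True
    \<comment> \<open>Equal homes: parts of different index are disjoint across both names, so a
      single tripartition serves them together.\<close>
    let ?g = "\<lambda>v. if \<tau> m v < 3 then \<tau> m v else if \<tau> m' v < 3 then \<tau> m' v else 0"
    have g: "?g v = \<alpha>" if "\<alpha> < 3" "v \<in> Z m \<alpha> \<or> v \<in> Z m' \<alpha>" for \<alpha> v
    proof (cases "\<tau> m v < 3")
      case t: True
      have "\<tau> m v = \<alpha>"
      proof (rule ccontr)
        assume "\<tau> m v \<noteq> \<alpha>"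
        then have "Z m (\<tau> m v) \<inter> Z m' \<alpha> = {}" "Z m (\<tau> m v) \<inter> Z m \<alpha> = {}"
          using same[OF m True t that(1)] same[OF m(1,1) refl t that(1)] by simp_all
        then show False using tauD[OF m(1) t] that(2) by blast
      qed
      then show ?thesis using t by simp
    next
      case False
      then have "v \<notin> Z m \<alpha>" using tau[OF m(1) _ that(1), of v] that(1) by auto
      then show ?thesis using that False tau[OF m(2) _ that(1)] by simp
    qed
    have "?g ` e = {0, 1, 2}" if e: "e \<in> edges H" for e
      using red[OF e]
    proof
      assume "red_triple Z f m e"
      then show ?thesis by (rule image) (rule g; blast)
    next
      assume "red_triple Z f m' e"
      then show ?thesis by (rule image) (rule g; blast)
    qed
    moreover have "?g v < 3" for v by simp
    ultimately show ?thesis by (intro iterated_tripartite_two_levels[OF H, of ?g "\<lambda>_. 0" 0]) simp_all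
  next
    case False
    have main: "iterated_tripartite H"
      if m: "m \<in> M" "m' \<in> M" and s: "s < 3" and const: "\<And>v. \<tau> m v < 3 \<Longrightarrow> \<tau> m' v < 3 \<Longrightarrow> \<tau> m v = s"
        and red: "\<And>e. e \<in> edges H \<Longrightarrow> red_triple Z f m e \<or> red_triple Z f m' e" for m m' s
    proof (rule iterated_tripartite_two_levels[OF H, of "\<lambda>v. if \<tau> m v < 3 then \<tau> m v else s"
          "\<lambda>v. if \<tau> m' v < 3 then \<tau> m' v else 0" s])
      \<comment> \<open>The default \<open>s\<close> sends vertices outside the support of
        \<open>m\<close> to the part in which \<open>m\<close> is constant on the common support, so
        all red triples of \<open>m'\<close> lie inside part \<open>s\<close>.\<close>
      let ?g = "\<lambda>v. if \<tau> m v < 3 then \<tau> m v else s" and ?h = "\<lambda>v. if \<tau> m' v < 3 then \<tau> m' v else 0"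
      fix e assume "e \<in> edges H"
      then consider "red_triple Z f m e" | "red_triple Z f m' e" using red by blast
      then show "?g ` e = {0, 1, 2} \<or> (\<forall>v\<in>e. ?g v = s) \<and> ?h ` e = {0, 1, 2}"
      proof cases
        case 1
        then show ?thesis using image[OF 1, of ?g] tau[OF m(1)] by auto
      next
        case 2
        have "?g v = s" if v: "v \<in> e" for v
          using in_part[OF 2 v] tau[OF m(2)] const[of v] by auto
        moreover have "?h ` e = {0, 1, 2}" by (rule image[OF 2]) (use tau[OF m(2)] in auto)
        ultimately show ?thesis by blast
      qed
    qed (use s in auto)
    \<comment> \<open>Two functions on a set such that no pair of points is separated by both: one is constant.\<close>
    have both: "\<tau> m x = \<tau> m y \<or> \<tau> m' x = \<tau> m' y"
      if "\<tau> m x < 3" "\<tau> m' x < 3" "\<tau> m y < 3" "\<tau> m' y < 3" for x y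
      using diff[OF m False that(1,3,2,4) _ _ tauD[OF m(1) that(1)] tauD[OF m(2) that(2)] tauD[OF m(1) that(3)] tauD[OF m(2) that(4)]]
      by satx
    have "(\<exists>s<3. \<forall>v. \<tau> m v < 3 \<longrightarrow> \<tau> m' v < 3 \<longrightarrow> \<tau> m v = s) \<or> (\<exists>s<3. \<forall>v. \<tau> m' v < 3 \<longrightarrow> \<tau> m v < 3 \<longrightarrow> \<tau> m' v = s)"
    proof (rule ccontr)
      assume neg: "\<not> ?thesis"
      then obtain x where x: "\<tau> m x < 3" "\<tau> m' x < 3" using zero_less_numeral by blast
      obtain y where y: "\<tau> m y < 3" "\<tau> m' y < 3" "\<tau> m y \<noteq> \<tau> m x" using neg x by blast
      obtain z where z: "\<tau> m z < 3" "\<tau> m' z < 3" "\<tau> m' z \<noteq> \<tau> m' x" using neg x by blast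
      \<comment> \<open>\<open>y\<close> differs from \<open>x\<close> under \<open>m\<close> only
        and \<open>z\<close> differs from \<open>x\<close> under \<open>m'\<close> only, so
        \<open>y\<close> and \<open>z\<close> differ under both.\<close>
      show False using both[OF x y(1,2)] both[OF x z(1,2)] both[OF y(1,2) z(1,2)] y z by auto
    qed
    then show ?thesis
    proof
      assume "\<exists>s<3. \<forall>v. \<tau> m v < 3 \<longrightarrow> \<tau> m' v < 3 \<longrightarrow> \<tau> m v = s"
      then obtain s where s: "s < 3" "\<forall>v. \<tau> m v < 3 \<longrightarrow> \<tau> m' v < 3 \<longrightarrow> \<tau> m v = s" by blast
      show ?thesis by (rule main[OF m s(1) s(2)[rule_format] red])
    next
      assume "\<exists>s<3. \<forall>v. \<tau> m' v < 3 \<longrightarrow> \<tau> m v < 3 \<longrightarrow> \<tau> m' v = s"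
      then obtain s where s: "s < 3" "\<forall>v. \<tau> m' v < 3 \<longrightarrow> \<tau> m v < 3 \<longrightarrow> \<tau> m' v = s" by blast
      have red': "red_triple Z f m' e \<or> red_triple Z f m e" if "e \<in> edges H" for e
        using red[OF that] by (rule disj_commute[THEN iffD1])
      show ?thesis by (rule main[OF m(2,1) s(1) s(2)[rule_format] red'])
    qed
  qed
qed

lemma iterated_tripartite_if_two_components:
  fixes Z :: "'m \<Rightarrow> nat \<Rightarrow> nat set" and home :: "'m \<Rightarrow> 'h"
  assumes H: "three_graph H"
    and same: "\<And>m m' \<alpha> \<beta>. m \<in> M \<Longrightarrow> m' \<in> M \<Longrightarrow> home m = home m' \<Longrightarrow> \<alpha> < 3 \<Longrightarrow> \<beta> < 3 \<Longrightarrow> \<alpha> \<noteq> \<beta> \<Longrightarrow> Z m \<alpha> \<inter> Z m' \<beta> = {}"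
    and diff: "\<And>m m' \<alpha> \<beta> \<alpha>' \<beta>' x y. m \<in> M \<Longrightarrow> m' \<in> M \<Longrightarrow> home m \<noteq> home m' \<Longrightarrow> \<alpha> < 3 \<Longrightarrow> \<beta> < 3 \<Longrightarrow> \<alpha>' < 3 \<Longrightarrow> \<beta>' < 3 \<Longrightarrow>
        \<alpha> \<noteq> \<beta> \<Longrightarrow> \<alpha>' \<noteq> \<beta>' \<Longrightarrow> x \<in> Z m \<alpha> \<Longrightarrow> x \<in> Z m' \<alpha>' \<Longrightarrow> y \<in> Z m \<beta> \<Longrightarrow> y \<in> Z m' \<beta>' \<Longrightarrow> False"
    and red: "\<And>e. e \<in> edges H \<Longrightarrow> \<exists>m\<in>M. red_triple Z f m e"
    and few: "card {K. tight_component H K} \<le> 2"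
  shows "iterated_tripartite H"
proof (cases "edges H = {}")
  case True
  then show ?thesis using iterated_tripartite_two_levels[OF H, of "\<lambda>_. 0" "\<lambda>_. 0" 0] by simp
next
  case False
  from red obtain lab where lab: "\<And>e. e \<in> edges H \<Longrightarrow> lab e \<in> M \<and> red_triple Z f (lab e) e" by metis
  have "f p = lab e" if "e \<in> edges H" "p \<subseteq> e" "card p = 2" for e p
    by (rule red_triple_pair[OF conjunct2[OF lab[OF that(1)]] that(2,3)])
  note * = card_labels_le_tight_components[OF H this]
  have "finite (lab ` edges H)" "card (lab ` edges H) \<le> 2"
    using *(1) order.trans[OF *(2) few] by simp_all
  moreover obtain e where e: "e \<in> edges H" using False by blast
  ultimately have "card (lab ` edges H - {lab e}) \<le> 1" by (simp add: card_Diff_singleton)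
  then obtain e' where e': "e' \<in> edges H" "lab ` edges H \<subseteq> {lab e, lab e'}"
  proof (cases "lab ` edges H \<subseteq> {lab e}")
    case False
    then obtain e' where e': "e' \<in> edges H" "lab e' \<noteq> lab e" by auto
    have "lab ` edges H - {lab e} = {lab e'}"
      using \<open>card (lab ` edges H - {lab e}) \<le> 1\<close> \<open>finite (lab ` edges H)\<close> e'
      by (intro card_seteq[symmetric]) auto
    then show ?thesis using that e' by blast
  qed (use that e in blast)
  show ?thesis
  proof (rule iterated_tripartite_if_two_labels[OF H _ _ same diff])
    show "lab e \<in> M" "lab e' \<in> M" using lab e e' by auto
    show "red_triple Z f (lab e) e'' \<or> red_triple Z f (lab e') e''" if "e'' \<in> edges H" for e''
      using lab[OF that] e'(2) that by (metis (no_types) image_subset_iff insertE singletonD)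
  qed
qed

section \<open>The colouring\<close>

lemma colouring_exists:
  assumes k: "2 \<le> k" and N: "3 * N < 2 ^ k\<^sup>2"
  shows "\<exists>\<chi> :: nat set \<Rightarrow> colour.
    (\<forall>H. subgraph H (complete_three_graph N) \<and> (\<forall>e\<in>edges H. \<chi> e = Red) \<and>
       card {K. tight_component H K} \<le> 2 \<longrightarrow> iterated_tripartite H) \<and>
    (\<forall>S \<subseteq> {..<N}. (\<forall>e\<in>edges (complete_three_graph N). e \<subseteq> S \<longrightarrow> \<chi> e = Blue) \<longrightarrow>
       card S < 2 ^ (2500 * k + 1))"
proof -
  define Q :: nat where "Q = 2 ^ (500 * k)"
  have points: "points k \<noteq> {}" using card_points[of k] by auto
  have unc: "card A * 2 ^ k\<^sup>2 \<le> card (points k)"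
    if "A \<subseteq> points k" "\<And>m. m \<in> names k \<Longrightarrow> \<exists>\<alpha><3. A \<inter> region k m \<alpha> = {}" for A
    using uncrossed_card[OF k that] .
  have "\<exists>X. (\<forall>a<N. X a \<in> points k) \<and>
      (\<forall>S\<subseteq>{..<N}. card S = Q \<longrightarrow> (\<exists>m\<in>names k. \<forall>\<alpha><3. \<exists>a\<in>S. X a \<in> region k m \<alpha>))"
    by (rule exists_crossing_sample[OF finite_points points finite_names _ _ N])
      (use card_names unc in \<open>auto simp: Q_def\<close>)
  then obtain X where X: "\<And>S. S \<subseteq> {..<N} \<Longrightarrow> card S = Q \<Longrightarrow> \<exists>m\<in>names k. \<forall>\<alpha><3. \<exists>a\<in>S. X a \<in> region k m \<alpha>"
    by blast
  define Z where "Z m \<alpha> = {a. X a \<in> region k m \<alpha>}" for m \<alpha>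
  have same: "Z m \<alpha> \<inter> Z m' \<beta> = {}"
    if "m \<in> names k" "m' \<in> names k" "home m = home m'" "\<alpha> < 3" "\<beta> < 3" "\<alpha> \<noteq> \<beta>" for m m' \<alpha> \<beta>
    using same_home_disjoint[OF that] by (auto simp: Z_def)
  have nonempty: "names k \<noteq> {}"
  proof
    assume "names k = {}"
    \<comment> \<open>With no names at all, the whole space would be uncrossed.\<close>
    then have "card (points k) * 2 ^ k\<^sup>2 \<le> card (points k)" using unc[of "points k"] by simp
    moreover have "0 < card (points k)" using points by (simp add: card_gt_0_iff)
    moreover have "(1::nat) < 2 ^ k\<^sup>2" using k by (intro one_less_power) auto
    ultimately show False by simp
  qed
  have "3 * k\<^sup>2 < Q"
  proof -
    have "k\<^sup>2 \<le> (2 ^ k)\<^sup>2" by (intro power_mono) auto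
    moreover have "0 < (2 ^ k :: nat)\<^sup>2" by simp
    ultimately have "3 * k\<^sup>2 < 2 ^ 2 * (2 ^ k)\<^sup>2" unfolding power2_eq_square[of 2] by linarith
    also have "\<dots> = 2 ^ (2 + 2 * k)" by (simp only: power_add power_mult mult.commute[of 2 k])
    also have "\<dots> \<le> 2 ^ (500 * k)" using k by (intro power_increasing) auto
    finally show ?thesis by (simp add: Q_def)
  qed
  moreover have "card (names k) \<le> Q" "N \<le> 2 ^ k\<^sup>2" using card_names[of k] N by (simp_all add: Q_def)
  note exists_labelling[OF finite_names nonempty this(1) calculation this(2)]
  then obtain f where f: "\<forall>m\<in>names k. \<forall>A B C. A \<union> B \<union> C \<subseteq> {..<N} \<longrightarrow> A \<inter> B = {} \<longrightarrow> A \<inter> C = {} \<longrightarrow> B \<inter> C = {} \<longrightarrow>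
      card A = Q ^ 4 \<longrightarrow> card B = Q ^ 4 \<longrightarrow> card C = Q ^ 4 \<longrightarrow>
      (\<exists>a\<in>A. \<exists>b\<in>B. \<exists>c\<in>C. f {a, b} = m \<and> f {b, c} = m \<and> f {a, c} = m)"
    by (elim exE)
  define \<chi> where "\<chi> e = (if \<exists>m\<in>names k. red_triple Z f m e then Red else Blue)" for e
  show ?thesis
  proof (intro exI[of _ \<chi>] conjI allI impI)
    fix H assume H: "subgraph H (complete_three_graph N) \<and> (\<forall>e\<in>edges H. \<chi> e = Red) \<and> card {K. tight_component H K} \<le> 2"
    show "iterated_tripartite H"
    proof (rule iterated_tripartite_if_two_components[OF _ same])
      show "three_graph H" "card {K. tight_component H K} \<le> 2" using H by (auto simp: subgraph_def)
      show "\<exists>m\<in>names k. red_triple Z f m e" if "e \<in> edges H" for e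
        using H that by (metis \<chi>_def colour.distinct(1))
      show False if "m \<in> names k" "m' \<in> names k" "home m \<noteq> home m'" "\<alpha> < 3" "\<beta> < 3" "\<alpha>' < 3" "\<beta>' < 3" "\<alpha> \<noteq> \<beta>" "\<alpha>' \<noteq> \<beta>'"
        "x \<in> Z m \<alpha>" "x \<in> Z m' \<alpha>'" "y \<in> Z m \<beta>" "y \<in> Z m' \<beta>'" for m m' \<alpha> \<beta> \<alpha>' \<beta>' x y
        using different_home_no_double_split[OF that(1-9)] that(10-) by (simp add: Z_def)
    qed
  next
    fix S assume S: "S \<subseteq> {..<N}" and blue: "\<forall>e\<in>edges (complete_three_graph N). e \<subseteq> S \<longrightarrow> \<chi> e = Blue"
    \<comment> \<open>The threshold of \<open>crossing_amplified\<close> for parts of size Q^4, the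
      size at which the labelling contains every name.\<close>
    have "card S < Q + Q * Q ^ 4"
    proof (rule ccontr)
      assume "\<not> ?thesis"
      moreover have "finite S" using S by (auto intro: finite_subset)
      ultimately obtain m where m: "m \<in> names k" "\<forall>\<alpha><3. Q ^ 4 \<le> card {a\<in>S. X a \<in> region k m \<alpha>}"
        using crossing_amplified[of S "names k" Q "Q ^ 4" X "region k"] card_names[of k] X S
        unfolding Q_def[symmetric] by force
      have "\<exists>A. A \<subseteq> S \<inter> Z m \<alpha> \<and> card A = Q ^ 4" if "\<alpha> < 3" for \<alpha>
      proof -
        have "{a\<in>S. X a \<in> region k m \<alpha>} = S \<inter> Z m \<alpha>" by (auto simp: Z_def)
        then show ?thesis using m(2) that by (metis obtain_subset_with_card_n)
      qed
      then obtain A where A: "\<And>\<alpha>. \<alpha> < 3 \<Longrightarrow> A \<alpha> \<subseteq> S \<inter> Z m \<alpha>" "\<And>\<alpha>. \<alpha> < 3 \<Longrightarrow> card (A \<alpha>) = Q ^ 4" by metis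
      have disj: "A 0 \<inter> A 1 = {}" "A 0 \<inter> A 2 = {}" "A 1 \<inter> A 2 = {}"
        using A(1)[of 0] A(1)[of 1] A(1)[of 2] same[OF m(1,1) refl, of 0 1] same[OF m(1,1) refl, of 0 2]
          same[OF m(1,1) refl, of 1 2] by auto
      have sub: "A 0 \<union> A 1 \<union> A 2 \<subseteq> {..<N}"
        using A(1)[of 0] A(1)[of 1] A(1)[of 2] S by auto
      obtain a b c where abc: "a \<in> A 0" "b \<in> A 1" "c \<in> A 2" "f {a, b} = m" "f {b, c} = m" "f {a, c} = m"
        using f[rule_format, OF m(1) sub disj A(2) A(2) A(2)] by auto
      have ne: "a \<noteq> b" "a \<noteq> c" "b \<noteq> c" using abc disj by auto
      have mem: "a \<in> S \<inter> Z m 0" "b \<in> S \<inter> Z m 1" "c \<in> S \<inter> Z m 2" using abc A(1)[of 0] A(1)[of 1] A(1)[of 2] by auto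
      then have "red_triple Z f m {a, b, c}" using abc unfolding red_triple_def by blast
      then have "\<chi> {a, b, c} = Red" using m(1) by (auto simp: \<chi>_def)
      moreover have "{a, b, c} \<in> edges (complete_three_graph N)" using mem S ne by (auto simp: complete_three_graph_def)
      ultimately show False using blue mem by auto
    qed
    also have "\<dots> \<le> 2 * Q ^ 5"
    proof -
      have "Q \<le> Q ^ 5" by (rule self_le_power) (simp_all add: Q_def)
      moreover have "Q * Q ^ 4 = Q ^ 5" by (simp flip: power_Suc)
      ultimately show ?thesis by simp
    qed
    also have "\<dots> = 2 ^ (2500 * k + 1)" by (simp add: Q_def flip: power_mult)
    finally show "card S < 2 ^ (2500 * k + 1)" .
  qed
qed

text \<open>In effect ln 2 >= 1/2, from e <= 4.\<close>

lemma exp_half_le_power_two: "exp (real m / 2) \<le> 2 ^ m"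
proof (rule power2_le_imp_le)
  have "(exp (real m / 2))\<^sup>2 = exp 1 ^ m" by (simp add: power2_eq_square flip: exp_add exp_of_nat_mult)
  also have "\<dots> \<le> 4 ^ m" using exp_le by (intro power_mono) auto
  also have "\<dots> = (2 ^ m)\<^sup>2" by (simp add: power2_eq_square flip: power_mult_distrib)
  finally show "(exp (real m / 2))\<^sup>2 \<le> (2 ^ m)\<^sup>2" .
qed simp

theorem theorem3p1:
  "\<exists>C::real. C > 0 \<and> (\<forall>N::nat. N \<ge> 2 \<longrightarrow>
     (\<exists>\<chi> :: nat set \<Rightarrow> colour.
        (\<forall>H. subgraph H (complete_three_graph N) \<and> (\<forall>e\<in>edges H. \<chi> e = Red) \<and>
              card {K. tight_component H K} \<le> 2 \<longrightarrow> iterated_tripartite H) \<and>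
        (\<forall>S \<subseteq> verts (complete_three_graph N).
              (\<forall>e\<in>edges (complete_three_graph N). e \<subseteq> S \<longrightarrow> \<chi> e = Blue) \<longrightarrow>
              real (card S) \<le> exp (C * sqrt (ln (real N))))))"
proof (intro exI[of _ 20008] conjI allI impI)
  fix N :: nat assume N: "2 \<le> N"
  define s where "s = sqrt (ln (real N))"
  \<comment> \<open>This gives k^2 >= 4 s^2 + 4, hence 2^(k^2) >= exp(k^2 / 2) >= e^2 N^2 >
    3N.\<close>
  define k where "k = nat \<lceil>2 * s\<rceil> + 2"
  have s2: "s\<^sup>2 = ln (real N)" using N by (simp add: s_def)
  have "s \<ge> 0" using N by (simp add: s_def)
  have "exp (1 / 2) \<le> (2 :: real)" using exp_half_le_power_two[of 1] by simp
  then have "1 / 2 \<le> ln (2 :: real)" by (subst ln_ge_iff) auto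
  also have "\<dots> \<le> ln (real N)" using N by simp
  finally have "(1 / 2)\<^sup>2 \<le> s\<^sup>2" unfolding s2 by (simp add: power2_eq_square)
  then have s: "1 / 2 \<le> s" using \<open>s \<ge> 0\<close> by (rule power2_le_imp_le)
  have k: "2 * s + 2 \<le> real k" "real k \<le> 2 * s + 3" using s by (simp_all add: k_def) linarith+
  have "4 * ln (real N) + 4 \<le> (2 * s + 2)\<^sup>2" using \<open>s \<ge> 0\<close> by (simp add: s2[symmetric] power2_eq_square algebra_simps)
  also have "\<dots> \<le> (real k)\<^sup>2" using k \<open>s \<ge> 0\<close> by (intro power_mono) auto
  finally have k2: "ln (real N) + ln (real N) + 1 + 1 \<le> real (k\<^sup>2) / 2" by simp
  have "real (3 * N) < real N * real N * 2 * 2" using N by simp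
  also have "\<dots> \<le> exp (ln (real N)) * exp (ln (real N)) * exp 1 * exp 1"
    using N exp_ge_add_one_self[of 1] by (intro mult_mono) auto
  also have "\<dots> = exp (ln (real N) + ln (real N) + 1 + 1)" by (simp only: exp_add)
  also have "\<dots> \<le> exp (real (k\<^sup>2) / 2)" using k2 by simp
  also have "\<dots> \<le> 2 ^ k\<^sup>2" by (rule exp_half_le_power_two)
  finally have "real (3 * N) < real (2 ^ k\<^sup>2)" by simp
  then have "3 * N < 2 ^ k\<^sup>2" by (simp only: of_nat_less_iff)
  moreover have "2 \<le> k" by (simp add: k_def)
  note colouring_exists[OF this calculation]
  then obtain \<chi> :: "nat set \<Rightarrow> colour" where
    red: "\<forall>H. subgraph H (complete_three_graph N) \<and> (\<forall>e\<in>edges H. \<chi> e = Red) \<and>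
       card {K. tight_component H K} \<le> 2 \<longrightarrow> iterated_tripartite H"
    and blue: "\<forall>S \<subseteq> {..<N}. (\<forall>e\<in>edges (complete_three_graph N). e \<subseteq> S \<longrightarrow> \<chi> e = Blue) \<longrightarrow>
       card S < 2 ^ (2500 * k + 1)"
    by (elim exE conjE)
  have bound: "real (2 ^ (2500 * k + 1)) \<le> exp (20008 * s)"
  proof -
    have "real (2 ^ (2500 * k + 1)) \<le> exp 1 ^ (2500 * k + 1)"
      using exp_ge_add_one_self[of 1] by (simp del: power_Suc add: power_mono)
    also have "\<dots> = exp (real (2500 * k + 1))"
      using exp_of_nat_mult[of "2500 * k + 1" "1::real"] by (simp only: mult_1_right)
    also have "\<dots> \<le> exp (20008 * s)"
    proof -
      have "real (2500 * k + 1) \<le> 2501 * real k" using \<open>2 \<le> k\<close> by simp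
      \<comment> \<open>s >= 1/2 turns k <= 2s + 3 into k <= 8s; the constant of the theorem is 2501
        * 8 = 20008.\<close>
      also have "\<dots> \<le> 2501 * (8 * s)" using k s by simp
      finally show ?thesis by simp
    qed
    finally show ?thesis .
  qed
  show "\<exists>\<chi> :: nat set \<Rightarrow> colour.
      (\<forall>H. subgraph H (complete_three_graph N) \<and> (\<forall>e\<in>edges H. \<chi> e = Red) \<and>
            card {K. tight_component H K} \<le> 2 \<longrightarrow> iterated_tripartite H) \<and>
      (\<forall>S \<subseteq> verts (complete_three_graph N).
            (\<forall>e\<in>edges (complete_three_graph N). e \<subseteq> S \<longrightarrow> \<chi> e = Blue) \<longrightarrow>
            real (card S) \<le> exp (20008 * sqrt (ln (real N))))"
  proof (intro exI[of _ \<chi>] conjI red allI impI)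
    fix S assume "S \<subseteq> verts (complete_three_graph N)"
      "\<forall>e\<in>edges (complete_three_graph N). e \<subseteq> S \<longrightarrow> \<chi> e = Blue"
    then have "card S < 2 ^ (2500 * k + 1)" using blue by (simp add: complete_three_graph_def)
    then have "real (card S) \<le> real (2 ^ (2500 * k + 1))" by (simp only: of_nat_le_iff)
    then show "real (card S) \<le> exp (20008 * sqrt (ln (real N)))" using bound by (simp only: s_def)
  qed
qed simp

end
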